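(* Let $N \geq 2$. For all $u \in C_{0}^{\infty}(\mathbb{R}^{N})$, $$\left(\int_{\mathbb{R}^{N}} |\nabla u|^{2}\,dx\right)^{\frac{1}{2}}\left(\int_{\mathbb{R}^{N}} |x|^{2} |u|^{2}\,dx\right)^{\frac{1}{2}}- \frac{N}{2} \int_{\mathbb{R}^{N}} |u|^{2}\,dx\ \geq\ \inf_{w \in \mathcal{Q}_{0}}\int_{\mathbb{R}^{N}}|u-w|^{2}dx+\inf_{w \in \mathcal{Q}_{1}}\int_{\mathbb{R}^{N}}|u-w|^{2}dx+\inf_{w \in \mathcal{Q}_{2}}\int_{\mathbb{R}^{N}}|u-w|^{2}dx.$$
   Context: Functions may be complex-valued. For $j\in\{0,1,2\}$, $\mathcal{Q}_{j}:=\left\{Q(x)\,e^{-\beta|x|^{2}}:\ Q \text{ a polynomial on } \mathbb{R}^N \text{ with complex coefficients of degree at most } j,\ \beta>0\right\}$. *)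

theory Defs
  imports "HOL-Analysis.Analysis"
begin

definition partial_deriv :: "'n::finite \<Rightarrow> (real^'n \<Rightarrow> complex) \<Rightarrow> real^'n \<Rightarrow> complex" where
  "partial_deriv i u x = frechet_derivative u (at x) (axis i 1)"

text \<open>The norm of \<^typ>\<open>complex^'n\<close> is Euclidean, so the squared norm of the gradient is the
  sum of the squared moduli of the partial derivatives.\<close>

definition gradient :: "(real^'n \<Rightarrow> complex) \<Rightarrow> real^'n \<Rightarrow> complex^'n" where
  "gradient u x = (\<chi> i. partial_deriv i u x)"

text \<open>Functions of class $C^k$. Requiring (Frechet) differentiability in the successor step makes
  the junk values of \<^const>\<open>frechet_derivative\<close> irrelevant; since the partial derivatives are
  themselves continuous, this is the usual notion.\<close>

primrec C_k :: "nat \<Rightarrow> (real^'n \<Rightarrow> complex) \<Rightarrow> bool" where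
  "C_k 0 u \<longleftrightarrow> continuous_on UNIV u"
| "C_k (Suc k) u \<longleftrightarrow> u differentiable_on UNIV \<and> (\<forall>i. C_k k (partial_deriv i u))"

definition test_functions :: "(real^'n \<Rightarrow> complex) set" where
  "test_functions = {u. (\<forall>k. C_k k u) \<and> compact (closure {x. u x \<noteq> 0})}"

definition multi_indices :: "nat \<Rightarrow> ('n::finite \<Rightarrow> nat) set" where
  "multi_indices j = {\<alpha>. (\<Sum>i\<in>UNIV. \<alpha> i) \<le> j}"

lemma finite_multi_indices: "finite (multi_indices j :: ('n::finite \<Rightarrow> nat) set)"
proof (rule finite_subset)
  show "multi_indices j \<subseteq> (PiE UNIV (\<lambda>_. {..j}) :: ('n \<Rightarrow> nat) set)"
  proof
    fix \<alpha> :: "'n \<Rightarrow> nat" assume "\<alpha> \<in> multi_indices j"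
    then have "(\<Sum>i\<in>UNIV. \<alpha> i) \<le> j" by (simp add: multi_indices_def)
    moreover have "\<alpha> i \<le> (\<Sum>i\<in>UNIV. \<alpha> i)" for i by (rule member_le_sum) auto
    ultimately show "\<alpha> \<in> PiE UNIV (\<lambda>_. {..j})" by (auto intro: order_trans)
  qed
qed (auto intro: finite_PiE)

definition monomial :: "('n::finite \<Rightarrow> nat) \<Rightarrow> real^'n \<Rightarrow> real" where
  "monomial \<alpha> x = (\<Prod>i\<in>UNIV. (x $ i) ^ \<alpha> i)"

text \<open>Polynomial functions of total degree at most \<open>j\<close>, including zero.\<close>

definition polys_le :: "nat \<Rightarrow> (real^'n \<Rightarrow> complex) set" where
  "polys_le j = {Q. \<exists>c. Q = (\<lambda>x. \<Sum>\<alpha>\<in>multi_indices j. c \<alpha> * of_real (monomial \<alpha> x))}"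

definition gauss_polys :: "nat \<Rightarrow> (real^'n \<Rightarrow> complex) set" where
  "gauss_polys j =
     {w. \<exists>Q \<beta>. Q \<in> polys_le j \<and> \<beta> > 0 \<and> w = (\<lambda>x. Q x * of_real (exp (- \<beta> * (norm x)\<^sup>2)))}"

end

theory Submission
  imports Defs "HOL-Probability.Distributions"
begin

text \<open>Fix \<open>b > 0\<close> and let \<open>g x = exp (- b |x|\<^sup>2 / 2)\<close> be the ground state of the harmonic oscillator
  with annihilation operators \<open>a\<^sub>i = \<partial>\<^sub>i + b x\<^sub>i\<close>. Integration by parts gives
  \<open>\<Sum>\<^sub>i \<parallel>a\<^sub>i u\<parallel>\<^sup>2 = \<parallel>\<nabla>u\<parallel>\<^sup>2 + b\<^sup>2 \<parallel>x u\<parallel>\<^sup>2 - b N \<parallel>u\<parallel>\<^sup>2\<close>. If \<open>w\<close> is the orthogonal projection of \<open>u\<close> onto the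
  polynomials of degree at most \<open>m\<close> times \<open>g\<close>, then \<open>a\<^sub>i w\<close> is the projection of \<open>a\<^sub>i u\<close>, one degree
  lower, so \<open>\<Sum>\<^sub>i \<parallel>a\<^sub>i u\<parallel>\<^sup>2 \<ge> \<Sum>\<^sub>i \<parallel>a\<^sub>i w\<parallel>\<^sup>2\<close>. On polynomials times \<open>g\<close> the number operator \<open>\<Sum>\<^sub>i a\<^sub>i\<^sup>* a\<^sub>i\<close> acts on
  the part of exact degree \<open>k\<close> as \<open>2 b k\<close>, whence \<open>\<Sum>\<^sub>i \<parallel>a\<^sub>i w\<parallel>\<^sup>2\<close> is \<open>2 b\<close> times the sum over \<open>j < m\<close> of the
  squared distances of \<open>w\<close> to the polynomials of degree at most \<open>j\<close> times \<open>g\<close>. Since polynomials times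
  \<open>g\<close> are dense, letting \<open>m\<close> tend to infinity yields the same lower bound for \<open>u\<close>; then \<open>b\<close> is
  optimised.\<close>

section \<open>Functions with Gaussian decay\<close>

text \<open>Negative \<open>t\<close> is allowed: \<open>gauss (- t)\<close> serves as the
  reciprocal of \<open>gauss t\<close>.\<close>

definition gauss :: "real \<Rightarrow> 'a::real_normed_vector \<Rightarrow> real" where
  "gauss t x = exp (- t * (norm x)\<^sup>2)"

lemma gauss_pos [simp]: "gauss t x > 0" "gauss t x \<ge> 0" "gauss t x \<noteq> 0"
  by (simp_all add: gauss_def)

lemma gauss_mult: "gauss s x * gauss t x = gauss (s + t) x"
  by (simp add: gauss_def exp_add [symmetric] algebra_simps)

lemma gauss_mono: "s \<le> t \<Longrightarrow> gauss t x \<le> gauss s x"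
  by (simp add: gauss_def mult_right_mono)

lemma gauss_le_1: "0 \<le> t \<Longrightarrow> gauss t x \<le> 1"
  using gauss_mono [of 0 t x] by (simp add: gauss_def)

lemma continuous_on_gauss [continuous_intros]: "continuous_on S (gauss t)"
  unfolding gauss_def by (intro continuous_intros)

lemma borel_measurable_gauss [measurable]:
  "(gauss t :: 'a::real_normed_vector \<Rightarrow> real) \<in> borel_measurable borel"
  by (intro borel_measurable_continuous_onI continuous_intros)

lemma integrable_gauss_real:
  assumes "t > 0"
  shows "integrable lborel (\<lambda>x::real. exp (- t * x\<^sup>2))"
proof -
  \<comment> \<open>With this standard deviation the exponent of the normal density is
    \<open>- t * x\<^sup>2\<close>; its normalising constant is multiplied away below.\<close>
  define s where "s = 1 / sqrt (2 * t)"
  have s: "s > 0" "2 * s\<^sup>2 = 1 / t" using assms by (simp_all add: s_def power_divide)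
  have "integrable lborel (\<lambda>x. sqrt (2 * pi * s\<^sup>2) * normal_density 0 s x)"
    by (intro integrable_mult_right integrable_normal_density s)
  moreover have "sqrt (2 * pi * s\<^sup>2) * normal_density 0 s x = exp (- t * x\<^sup>2)" for x
    using s assms by (simp add: normal_density_def mult.commute)
  ultimately show ?thesis by simp
qed

text \<open>By Tonelli the integral is a product of one-dimensional Gaussian integrals, one per
  basis vector.\<close>

lemma integrable_gauss:
  assumes "t > 0"
  shows "integrable lborel (gauss t :: 'a::euclidean_space \<Rightarrow> real)"
proof (rule integrableI_nonneg)
  have fin: "(\<integral>\<^sup>+x. ennreal (exp (- t * x\<^sup>2)) \<partial>lborel) < \<infinity>"
    using integrable_gauss_real [OF assms] by (simp add: integrable_iff_bounded)
  have prod: "(\<Prod>b\<in>Basis. ennreal (exp (- t * (x \<bullet> b)\<^sup>2))) = ennreal (gauss t x)" for x :: 'a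
  proof -
    have "gauss t x = (\<Prod>b\<in>Basis. exp (- t * (x \<bullet> b)\<^sup>2))"
      unfolding gauss_def
      by (simp add: exp_sum [symmetric] sum_distrib_left [symmetric] sum_negf
          power2_norm_eq_inner euclidean_inner [of x x] flip: power2_eq_square)
    then show ?thesis by (simp add: prod_ennreal)
  qed
  have "(\<integral>\<^sup>+x. ennreal (gauss t (x::'a)) \<partial>lborel)
      = (\<Prod>b\<in>(Basis::'a set). (\<integral>\<^sup>+x. ennreal (exp (- t * x\<^sup>2)) \<partial>lborel))"
    unfolding prod [symmetric] by (rule nn_integral_lborel_prod) auto
  also have "\<dots> < \<infinity>"
    using fin by (simp add: power_less_top_ennreal)
  finally show "(\<integral>\<^sup>+x. ennreal (gauss t (x::'a)) \<partial>lborel) < \<infinity>" .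
qed auto

text \<open>One class answers the integrability questions: it contains continuous functions of
  compact support as well as polynomials times Gaussians, and it is closed under sums, products and
  multiplication by polynomials.\<close>

definition gauss_decay :: "('a::euclidean_space \<Rightarrow> real) \<Rightarrow> bool" where
  "gauss_decay f \<longleftrightarrow> f \<in> borel_measurable borel \<and> (\<exists>C. \<exists>t>0. \<forall>x. \<bar>f x\<bar> \<le> C * gauss t x)"

lemma gauss_decay_measurable: "gauss_decay f \<Longrightarrow> f \<in> borel_measurable borel"
  by (simp add: gauss_decay_def)

lemma gauss_decayI:
  "f \<in> borel_measurable borel \<Longrightarrow> t > 0 \<Longrightarrow> (\<And>x. \<bar>f x\<bar> \<le> C * gauss t x) \<Longrightarrow> gauss_decay f"
  by (auto simp: gauss_decay_def)

lemma gauss_decayE: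
  assumes "gauss_decay f"
  obtains C t where "C \<ge> 0" "t > 0" "\<And>x. \<bar>f x\<bar> \<le> C * gauss t x"
proof -
  obtain C t where *: "t > 0" "\<And>x. \<bar>f x\<bar> \<le> C * gauss t x"
    using assms by (auto simp: gauss_decay_def)
  have "0 \<le> C * gauss t (0::'a)" by (rule order_trans [OF abs_ge_zero *(2)])
  then have "C \<ge> 0" using gauss_pos(1) [of t "0::'a"] by (simp add: zero_le_mult_iff del: gauss_pos)
  with * show ?thesis using that by blast
qed

lemma gauss_decay_gauss: "t > 0 \<Longrightarrow> gauss_decay (gauss t)"
  by (rule gauss_decayI [of _ t 1]) auto

lemma gauss_decay_integrable:
  assumes "gauss_decay f" shows "integrable lborel f"
proof -
  obtain C t where *: "C \<ge> 0" "t > 0" "\<And>x. \<bar>f x\<bar> \<le> C * gauss t x"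
    using gauss_decayE [OF assms] by metis
  show ?thesis
  proof (rule Bochner_Integration.integrable_bound)
    show "integrable lborel (\<lambda>x. C * gauss t x)"
      by (intro integrable_mult_right integrable_gauss *)
  qed (use * gauss_decay_measurable [OF assms] in \<open>auto simp: abs_mult\<close>)
qed

lemma gauss_decay_add:
  assumes f: "gauss_decay f" and g: "gauss_decay g"
  shows "gauss_decay (\<lambda>x. f x + g x)"
proof -
  obtain C s where 1: "C \<ge> 0" "s > 0" "\<And>x. \<bar>f x\<bar> \<le> C * gauss s x" using gauss_decayE [OF f] by metis
  obtain D t where 2: "D \<ge> 0" "t > 0" "\<And>x. \<bar>g x\<bar> \<le> D * gauss t x" using gauss_decayE [OF g] by metis
  show ?thesis
  proof (rule gauss_decayI [of _ "min s t" "C + D"])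
    fix x :: 'a
    have "C * gauss s x \<le> C * gauss (min s t) x" "D * gauss t x \<le> D * gauss (min s t) x"
      using 1 2 by (auto intro!: mult_left_mono gauss_mono)
    then show "\<bar>f x + g x\<bar> \<le> (C + D) * gauss (min s t) x"
      using 1(3) [of x] 2(3) [of x] by (simp add: distrib_right)
  qed (use 1 2 gauss_decay_measurable [OF f] gauss_decay_measurable [OF g] in auto)
qed

lemma gauss_decay_mult:
  assumes f: "gauss_decay f" and g: "gauss_decay g"
  shows "gauss_decay (\<lambda>x. f x * g x)"
proof -
  obtain C s where 1: "C \<ge> 0" "s > 0" "\<And>x. \<bar>f x\<bar> \<le> C * gauss s x" using gauss_decayE [OF f] by metis
  obtain D t where 2: "D \<ge> 0" "t > 0" "\<And>x. \<bar>g x\<bar> \<le> D * gauss t x" using gauss_decayE [OF g] by metis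
  show ?thesis
  proof (rule gauss_decayI [of _ "s + t" "C * D"])
    fix x :: 'a
    have "\<bar>f x\<bar> * \<bar>g x\<bar> \<le> (C * gauss s x) * (D * gauss t x)"
      using 1 2 by (intro mult_mono) auto
    then show "\<bar>f x * g x\<bar> \<le> C * D * gauss (s + t) x"
      by (simp add: abs_mult gauss_mult [symmetric] mult_ac)
  qed (use 1 2 gauss_decay_measurable [OF f] gauss_decay_measurable [OF g] in auto)
qed

lemma gauss_decay_cmult: "gauss_decay f \<Longrightarrow> gauss_decay (\<lambda>x. c * f x)"
proof -
  assume f: "gauss_decay f"
  obtain C s where 1: "C \<ge> 0" "s > 0" "\<And>x. \<bar>f x\<bar> \<le> C * gauss s x" using gauss_decayE [OF f] by metis
  show ?thesis
    by (rule gauss_decayI [of _ s "\<bar>c\<bar> * C"])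
       (use 1 gauss_decay_measurable [OF f] in \<open>auto simp: abs_mult mult.assoc intro!: mult_left_mono\<close>)
qed

lemma gauss_decay_diff: "gauss_decay f \<Longrightarrow> gauss_decay g \<Longrightarrow> gauss_decay (\<lambda>x. f x - g x)"
  using gauss_decay_add [of f "\<lambda>x. -1 * g x"] gauss_decay_cmult [of g "-1"] by simp

lemma gauss_decay_zero: "gauss_decay (\<lambda>_. 0)"
  by (rule gauss_decayI [of _ 1 0]) auto

lemma gauss_decay_sum:
  "(\<And>i. i \<in> I \<Longrightarrow> gauss_decay (f i)) \<Longrightarrow> gauss_decay (\<lambda>x. \<Sum>i\<in>I. f i x)"
  by (induction I rule: infinite_finite_induct) (auto intro: gauss_decay_zero gauss_decay_add)

lemma gauss_decay_power2: "gauss_decay f \<Longrightarrow> gauss_decay (\<lambda>x. (f x)\<^sup>2)"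
  by (simp add: power2_eq_square gauss_decay_mult)

text \<open>A dominating function for the difference quotients of a function with Gaussian decay.\<close>

lemma gauss_shift_le:
  assumes "t > 0" "norm h \<le> 1"
  shows "gauss t (x + h) \<le> exp t * gauss (t / 2) x"
proof -
  have "norm x \<le> norm (x + h) + 1"
    using norm_triangle_ineq4 [of "x + h" h] assms by simp
  then have "(norm x)\<^sup>2 \<le> (norm (x + h) + 1)\<^sup>2" by (intro power_mono) auto
  also have "\<dots> \<le> 2 * (norm (x + h))\<^sup>2 + 2"
    using zero_le_power2 [of "norm (x + h) - 1"] by (simp add: power2_eq_square algebra_simps)
  finally have "t * (norm x)\<^sup>2 \<le> t * (2 * (norm (x + h))\<^sup>2 + 2)"
    using assms by (intro mult_left_mono) auto
  then show ?thesis
    by (simp add: gauss_def exp_add [symmetric] algebra_simps)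
qed

section \<open>Partial derivatives along coordinate lines and integration by parts\<close>

definition has_partial :: "'n::finite \<Rightarrow> (real^'n \<Rightarrow> real) \<Rightarrow> (real^'n \<Rightarrow> real) \<Rightarrow> bool" where
  "has_partial i f f' \<longleftrightarrow>
     (\<forall>x. ((\<lambda>t. f (x + t *\<^sub>R axis i 1)) has_real_derivative f' x) (at 0))"

lemma has_partial_line:
  assumes "has_partial i f f'"
  shows "((\<lambda>t. f (x + t *\<^sub>R axis i 1)) has_real_derivative f' (x + t *\<^sub>R axis i 1)) (at t)"
proof -
  have "((\<lambda>s. f (x + t *\<^sub>R axis i 1 + s *\<^sub>R axis i 1)) has_real_derivative
          f' (x + t *\<^sub>R axis i 1)) (at 0)"
    using assms by (simp add: has_partial_def)
  then show ?thesis
    using DERIV_shift [of "\<lambda>t. f (x + t *\<^sub>R axis i 1)" "f' (x + t *\<^sub>R axis i 1)" 0 t]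
    by (simp add: scaleR_add_left add_ac)
qed

lemma has_partial_add: "has_partial i f f' \<Longrightarrow> has_partial i g g' \<Longrightarrow>
    has_partial i (\<lambda>x. f x + g x) (\<lambda>x. f' x + g' x)"
  by (auto simp: has_partial_def intro!: DERIV_add)

lemma has_partial_diff: "has_partial i f f' \<Longrightarrow> has_partial i g g' \<Longrightarrow>
    has_partial i (\<lambda>x. f x - g x) (\<lambda>x. f' x - g' x)"
  by (auto simp: has_partial_def intro!: DERIV_diff)

lemma has_partial_mult:
  assumes "has_partial i f f'" "has_partial i g g'"
  shows "has_partial i (\<lambda>x. f x * g x) (\<lambda>x. f' x * g x + f x * g' x)"
  unfolding has_partial_def
proof
  fix x
  show "((\<lambda>t. f (x + t *\<^sub>R axis i 1) * g (x + t *\<^sub>R axis i 1)) has_real_derivative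
          f' x * g x + f x * g' x) (at 0)"
    using DERIV_mult [OF assms [unfolded has_partial_def, THEN spec, of x]] by (simp add: mult_ac add_ac)
qed

lemma has_partial_const: "has_partial i (\<lambda>_. c) (\<lambda>_. 0)"
  by (simp add: has_partial_def)

lemma has_partial_coord: "has_partial i (\<lambda>x. x $ j) (\<lambda>_. if i = j then 1 else 0)"
  unfolding has_partial_def by (auto intro!: derivative_eq_intros simp: axis_def)

lemma norm_sum_coord: "(norm (x::real^'n))\<^sup>2 = (\<Sum>i\<in>UNIV. (x $ i)\<^sup>2)"
  by (simp add: norm_vec_def L2_set_def sum_nonneg)

lemma has_partial_gauss: "has_partial i (gauss t) (\<lambda>x. - 2 * t * x $ i * gauss t x)"
  unfolding has_partial_def
proof
  fix x :: "real^'a"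
  have eq: "(norm (x + s *\<^sub>R axis i (1::real)))\<^sup>2 = (norm x)\<^sup>2 + 2 * s * x $ i + s\<^sup>2" for s :: real
    unfolding power2_norm_eq_inner
    by (simp add: inner_add_left inner_add_right inner_axis inner_axis' power2_eq_square
        algebra_simps)
  show "((\<lambda>s. gauss t (x + s *\<^sub>R axis i 1)) has_real_derivative - 2 * t * x $ i * gauss t x) (at 0)"
    unfolding gauss_def eq by (auto intro!: derivative_eq_intros)
qed

lemma integral_shift:
  fixes f :: "'a::euclidean_space \<Rightarrow> real"
  assumes "f \<in> borel_measurable borel"
  shows "(\<integral>x. f (x + c) \<partial>lborel) = (\<integral>x. f x \<partial>lborel)"
  using assms by (subst (2) lborel_distr_plus [of c, symmetric]) (simp add: integral_distr add.commute)

text \<open>Translation invariance makes every difference quotient integrate to zero. By the mean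
  value theorem a quotient is a value of \<open>f'\<close> at distance at most 1, so the Gaussian
  bound of \<open>f'\<close> dominates all quotients and the limit may be taken under the
  integral.\<close>

lemma integral_partial_eq_0:
  assumes hp: "has_partial i f f'" and f: "gauss_decay f" and f': "gauss_decay f'"
  shows "(\<integral>x. f' x \<partial>lborel) = 0"
proof -
  define q where "q = (\<lambda>n x. (f (x + (1 / real (Suc n)) *\<^sub>R axis i 1) - f x) * real (Suc n))"
  have [measurable]: "f \<in> borel_measurable borel" "f' \<in> borel_measurable borel"
    using f f' by (simp_all add: gauss_decay_measurable)
  obtain C t where C: "C \<ge> 0" "t > 0" "\<And>x. \<bar>f' x\<bar> \<le> C * gauss t x" using gauss_decayE [OF f'] by metis
  have int_shift: "integrable lborel (\<lambda>x. f (x + c))" for c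
    using gauss_decay_integrable [OF f]
    by (subst (asm) lborel_distr_plus [of c, symmetric]) (simp add: integrable_distr_eq add.commute)
  have "(\<integral>x. q n x \<partial>lborel) = 0" for n
    unfolding q_def using gauss_decay_integrable [OF f] int_shift integral_shift [of f]
    by (simp add: Bochner_Integration.integral_diff)
  moreover have "(\<lambda>n. \<integral>x. q n x \<partial>lborel) \<longlonglongrightarrow> (\<integral>x. f' x \<partial>lborel)"
  proof (rule integral_dominated_convergence)
    show "integrable lborel (\<lambda>x::real^'a. C * exp t * gauss (t / 2) x)"
      using C by (intro integrable_mult_right integrable_gauss) auto
    show "AE x in lborel. norm (q n x) \<le> C * exp t * gauss (t / 2) x" for n
    proof (rule AE_I2)
      fix x :: "real^'a"
      obtain z where z: "0 < z" "z < 1 / real (Suc n)"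
        "f (x + (1 / real (Suc n)) *\<^sub>R axis i 1) - f (x + 0 *\<^sub>R axis i 1)
           = (1 / real (Suc n) - 0) * f' (x + z *\<^sub>R axis i 1)"
        using MVT2 [of 0 "1 / real (Suc n)" "\<lambda>t. f (x + t *\<^sub>R axis i 1)"
            "\<lambda>t. f' (x + t *\<^sub>R axis i 1)"] has_partial_line [OF hp] by auto
      have "z \<le> 1" using z(2) by (rule order.strict_implies_order [THEN order_trans]) simp
      have "q n x = f' (x + z *\<^sub>R axis i 1)"
        using z(3) unfolding q_def by simp
      then have "\<bar>q n x\<bar> \<le> C * gauss t (x + z *\<^sub>R axis i 1)" using C by simp
      also have "\<dots> \<le> C * (exp t * gauss (t / 2) x)"
        using C z \<open>z \<le> 1\<close> by (intro mult_left_mono gauss_shift_le) auto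
      finally show "norm (q n x) \<le> C * exp t * gauss (t / 2) x" by (simp add: mult.assoc)
    qed
    show "AE x in lborel. (\<lambda>n. q n x) \<longlonglongrightarrow> f' x"
    proof (rule AE_I2)
      fix x :: "real^'a"
      have "((\<lambda>h. (f (x + h *\<^sub>R axis i 1) - f x) / h) \<longlongrightarrow> f' x) (at 0)"
        using hp unfolding has_partial_def DERIV_def by simp
      moreover have "filterlim (\<lambda>n. 1 / real (Suc n)) (at 0) sequentially"
        using LIMSEQ_inverse_real_of_nat by (simp add: filterlim_at inverse_eq_divide)
      ultimately have "(\<lambda>n. (f (x + (1 / real (Suc n)) *\<^sub>R axis i 1) - f x) / (1 / real (Suc n)))
          \<longlonglongrightarrow> f' x"
        by (rule filterlim_compose)
      then show "(\<lambda>n. q n x) \<longlonglongrightarrow> f' x" by (simp add: q_def)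
    qed
  qed (simp_all add: q_def)
  ultimately show ?thesis by (simp add: LIMSEQ_const_iff)
qed

lemma integral_by_parts_partial:
  assumes "has_partial i f f'" "has_partial i g g'"
    and "gauss_decay f" "gauss_decay f'" "gauss_decay g" "gauss_decay g'"
  shows "(\<integral>x. f' x * g x \<partial>lborel) = - (\<integral>x. f x * g' x \<partial>lborel)"
proof -
  have 1: "gauss_decay (\<lambda>x. f' x * g x)" and 2: "gauss_decay (\<lambda>x. f x * g' x)"
    and 3: "gauss_decay (\<lambda>x. f x * g x)"
    using assms by (auto intro: gauss_decay_mult)
  have "(\<integral>x. f' x * g x + f x * g' x \<partial>lborel) = 0"
    using integral_partial_eq_0 [OF has_partial_mult [OF assms(1,2)] 3] 1 2 gauss_decay_add by blast
  then show ?thesis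
    using gauss_decay_integrable [OF 1] gauss_decay_integrable [OF 2] by simp
qed

section \<open>Polynomials and orthogonal projections\<close>

text \<open>\<open>poly_lt m Q\<close> means that \<open>Q\<close> is a polynomial of degree \<open>< m\<close>; with the strict bound
  \<open>m = 0\<close> describes the zero polynomial, so lowering the degree needs no case distinction.\<close>

inductive poly_lt :: "nat \<Rightarrow> (real^'n \<Rightarrow> real) \<Rightarrow> bool" where
  zero: "poly_lt m (\<lambda>_. 0)"
| const: "poly_lt (Suc m) (\<lambda>_. c)"
| add: "poly_lt m P \<Longrightarrow> poly_lt m Q \<Longrightarrow> poly_lt m (\<lambda>x. P x + Q x)"
| coord: "poly_lt m Q \<Longrightarrow> poly_lt (Suc m) (\<lambda>x. x $ i * Q x)"
| lift: "poly_lt m Q \<Longrightarrow> poly_lt (Suc m) Q"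

lemma poly_lt_0: "poly_lt m Q \<Longrightarrow> m = 0 \<Longrightarrow> Q = (\<lambda>_. 0)"
  by (induction rule: poly_lt.induct) auto

lemma poly_lt_mono: "poly_lt m Q \<Longrightarrow> m \<le> n \<Longrightarrow> poly_lt n Q"
  by (rule dec_induct [of m n]) (auto intro: poly_lt.lift)

lemma poly_lt_cmult: "poly_lt m Q \<Longrightarrow> poly_lt m (\<lambda>x. c * Q x)"
proof (induction rule: poly_lt.induct)
  case (coord m Q i)
  then show ?case using poly_lt.coord [of m "\<lambda>x. c * Q x" i] by (simp add: mult.left_commute)
qed (auto simp: distrib_left intro: poly_lt.intros)

lemma poly_lt_diff: "poly_lt m P \<Longrightarrow> poly_lt m Q \<Longrightarrow> poly_lt m (\<lambda>x. P x - Q x)"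
  using poly_lt.add [of m P "\<lambda>x. -1 * Q x"] poly_lt_cmult [of m Q "-1"] by simp

lemma poly_lt_sum: "(\<And>i. i \<in> I \<Longrightarrow> poly_lt m (f i)) \<Longrightarrow> poly_lt m (\<lambda>x. \<Sum>i\<in>I. f i x)"
  by (induction I rule: infinite_finite_induct) (auto intro: poly_lt.zero poly_lt.add)

lemma poly_lt_mult:
  assumes "poly_lt m P" "poly_lt n Q"
  shows "poly_lt (m + n) (\<lambda>x. P x * Q x)"
  using assms
proof (induction rule: poly_lt.induct)
  case (const m c)
  then show ?case by (auto intro: poly_lt_cmult poly_lt_mono)
next
  case (coord m P i)
  then show ?case using poly_lt.coord [of "m + n" "\<lambda>x. P x * Q x" i] by (simp add: mult.assoc)
qed (auto simp: distrib_right intro: poly_lt.intros)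

lemma poly_lt_power: "poly_lt m P \<Longrightarrow> \<exists>n. poly_lt n (\<lambda>x. P x ^ k)"
proof (induction k)
  case 0
  then show ?case using poly_lt.const [of 0 1] by auto
next
  case (Suc k)
  then show ?case by (auto dest: poly_lt_mult)
qed

lemma poly_lt_norm2: "poly_lt 3 (\<lambda>x::real^'n. (norm x)\<^sup>2)"
proof -
  have "poly_lt 3 (\<lambda>x::real^'n. x $ i * (x $ i * 1))" for i
    using poly_lt.coord [OF poly_lt.coord [OF poly_lt.const [of 0 1], of i], of i]
    by (simp add: numeral_3_eq_3)
  then show ?thesis
    unfolding norm_sum_coord by (intro poly_lt_sum) (simp add: power2_eq_square)
qed

lemma poly_lt_continuous: "poly_lt m Q \<Longrightarrow> continuous_on UNIV Q"
  by (induction rule: poly_lt.induct) (auto intro!: continuous_intros)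

text \<open>Half of the decay rate is given up to absorb the linear growth of the
  coordinate.\<close>

lemma gauss_decay_coord:
  fixes f :: "real^'n \<Rightarrow> real"
  assumes f: "gauss_decay f"
  shows "gauss_decay (\<lambda>x. x $ i * f x)"
proof -
  obtain C t where *: "C \<ge> 0" "t > 0" "\<And>x. \<bar>f x\<bar> \<le> C * gauss t x" using gauss_decayE [OF f] by metis
  have [measurable]: "f \<in> borel_measurable borel" "(\<lambda>x::real^'n. x $ i) \<in> borel_measurable borel"
    using f by (auto simp: gauss_decay_measurable intro!: borel_measurable_continuous_onI continuous_intros)
  show ?thesis
  proof (rule gauss_decayI [of _ "t / 2" "(1 + 2 / t) * C"])
    fix x :: "real^'n"
    have "\<bar>x $ i\<bar> \<le> norm x" by (rule component_le_norm_cart)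
    also have "\<dots> \<le> 1 + (norm x)\<^sup>2"
      using zero_le_power2 [of "norm x - 1/2"] by (simp add: power2_eq_square algebra_simps)
    \<comment> \<open>The factor \<open>1 + 2 / t\<close> creates the argument
      \<open>t / 2 * (norm x)\<^sup>2\<close>, to which \<open>1 + y \<le> exp y\<close>
      applies.\<close>
    also have "\<dots> \<le> (1 + 2 / t) * (1 + t / 2 * (norm x)\<^sup>2)"
      using * by (simp add: field_simps)
    also have "\<dots> \<le> (1 + 2 / t) * gauss (- (t / 2)) x"
      using * exp_ge_add_one_self [of "t / 2 * (norm x)\<^sup>2"]
      by (intro mult_left_mono) (auto simp: gauss_def)
    finally have "\<bar>x $ i\<bar> * \<bar>f x\<bar> \<le> ((1 + 2 / t) * gauss (- (t / 2)) x) * (C * gauss t x)"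
      using * by (intro mult_mono) auto
    also have "\<dots> = (1 + 2 / t) * C * (gauss (- (t / 2)) x * gauss t x)" by (simp only: mult_ac)
    also have "\<dots> = (1 + 2 / t) * C * gauss (t / 2) x" by (simp add: gauss_mult)
    finally show "\<bar>x $ i * f x\<bar> \<le> (1 + 2 / t) * C * gauss (t / 2) x" by (simp add: abs_mult)
  qed (use * in auto)
qed

lemma gauss_decay_poly_mult: "poly_lt m Q \<Longrightarrow> gauss_decay f \<Longrightarrow> gauss_decay (\<lambda>x. Q x * f x)"
proof (induction rule: poly_lt.induct)
  case (coord m Q i)
  then show ?case using gauss_decay_coord [of "\<lambda>x. Q x * f x" i] by (simp add: mult.assoc)
qed (auto simp: distrib_right intro: gauss_decay_zero gauss_decay_cmult gauss_decay_add)

lemma gauss_decay_poly: "poly_lt m Q \<Longrightarrow> t > 0 \<Longrightarrow> gauss_decay (\<lambda>x. Q x * gauss t x)"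
  by (intro gauss_decay_poly_mult gauss_decay_gauss)

section \<open>Derivatives of polynomials and Euler's identity\<close>

definition pd :: "'n::finite \<Rightarrow> (real^'n \<Rightarrow> real) \<Rightarrow> real^'n \<Rightarrow> real" where
  "pd i f x = deriv (\<lambda>t. f (x + t *\<^sub>R axis i 1)) 0"

lemma pd_eq: "has_partial i f f' \<Longrightarrow> pd i f = f'"
  by (rule ext) (simp add: has_partial_def pd_def DERIV_imp_deriv)

lemma has_partial_poly:
  assumes "poly_lt m Q"
  shows "has_partial i Q (pd i Q) \<and> poly_lt (m - 1) (pd i Q)"
proof -
  have "\<exists>Q'. has_partial i Q Q' \<and> poly_lt (m - 1) Q'"
    using assms
  proof (induction rule: poly_lt.induct)
    case (zero m)
    then show ?case using has_partial_const [of i 0] poly_lt.zero by blast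
  next
    case (const m c)
    then show ?case using has_partial_const [of i c] poly_lt.zero by blast
  next
    case (add m P Q)
    then show ?case using has_partial_add [of i P _ Q] poly_lt.add by blast
  next
    case (coord m Q j)
    then obtain Q' where Q': "has_partial i Q Q'" "poly_lt (m - 1) Q'" by blast
    have "has_partial i (\<lambda>x. x $ j * Q x) (\<lambda>x. (if i = j then 1 else 0) * Q x + x $ j * Q' x)"
      by (intro has_partial_mult has_partial_coord Q')
    moreover have "poly_lt m (\<lambda>x. (if i = j then 1 else 0) * Q x + x $ j * Q' x)"
    \<comment> \<open>\<open>poly_lt.coord\<close> bounds \<open>x $ j * Q' x\<close> by
      \<open>Suc (m - 1)\<close>, which is \<open>m\<close> only for \<open>m > 0\<close>; for
      \<open>m = 0\<close> both \<open>Q\<close> and \<open>Q'\<close> vanish.\<close>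
    proof (cases m)
      case 0
      then show ?thesis using coord poly_lt_0 [of m Q] poly_lt_0 [of "m - 1" Q'] Q'
        by (simp add: poly_lt.zero)
    next
      case (Suc k)
      have "poly_lt m (\<lambda>x. x $ j * Q' x)" using poly_lt.coord [OF Q'(2), of j] Suc by simp
      then show ?thesis by (intro poly_lt.add poly_lt_cmult coord.hyps)
    qed
    ultimately show ?case by auto
  next
    case (lift m Q)
    then obtain Q' where "has_partial i Q Q'" "poly_lt (m - 1) Q'" by blast
    then show ?case using poly_lt_mono [of "m - 1" Q' m] by auto
  qed
  then show ?thesis using pd_eq by blast
qed

lemma has_partial_poly_pd: "poly_lt m Q \<Longrightarrow> has_partial i Q (pd i Q)"
  and poly_lt_pd: "poly_lt m Q \<Longrightarrow> poly_lt (m - 1) (pd i Q)"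
  using has_partial_poly by blast+

lemma pd_add: "poly_lt m P \<Longrightarrow> poly_lt n Q \<Longrightarrow> pd i (\<lambda>x. P x + Q x) = (\<lambda>x. pd i P x + pd i Q x)"
  by (intro pd_eq has_partial_add has_partial_poly_pd)

lemma pd_coord_mult: "poly_lt m Q \<Longrightarrow>
    pd i (\<lambda>x. x $ j * Q x) = (\<lambda>x. (if i = j then 1 else 0) * Q x + x $ j * pd i Q x)"
  by (intro pd_eq has_partial_mult has_partial_coord has_partial_poly_pd)

text \<open>Euler's identity modulo lower degrees: the Euler field multiplies the part of exact
  degree \<open>m - 1\<close> by \<open>m - 1\<close>. The factor \<open>real m - 1\<close> is a
  subtraction of reals, so that the identity in the \<open>coord\<close> case also holds at
  \<open>m = 0\<close>.\<close>

lemma poly_lt_euler: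
  fixes Q :: "real^'n \<Rightarrow> real"
  assumes "poly_lt m Q"
  shows "poly_lt (m - 1) (\<lambda>x. (\<Sum>i\<in>UNIV. x $ i * pd i Q x) - (real m - 1) * Q x)"
  using assms
proof (induction rule: poly_lt.induct)
  case (zero m)
  have "pd i (\<lambda>_::real^'n. 0) = (\<lambda>_. 0)" for i by (intro pd_eq has_partial_const)
  then show ?case by (auto intro: poly_lt.zero)
next
  case (const m c)
  have "pd i (\<lambda>_::real^'n. c) = (\<lambda>_. 0)" for i by (intro pd_eq has_partial_const)
  \<comment> \<open>The remainder is \<open>- real m * c\<close>: zero if \<open>m = 0\<close>, an
    admissible constant otherwise.\<close>
  then show ?case by (cases m) (auto intro: poly_lt.zero poly_lt.const)
next
  case (add m P Q)
  then show ?case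
    using poly_lt.add [OF add.IH]
    by (simp add: pd_add distrib_left sum.distrib algebra_simps)
next
  case (coord m Q j)
  \<comment> \<open>Multiplication by \<open>x $ j\<close> raises the Euler eigenvalue by one,
    matching the shift from \<open>m\<close> to \<open>Suc m\<close>.\<close>
  have "(\<Sum>i\<in>UNIV. x $ i * pd i (\<lambda>x. x $ j * Q x) x) - (real (Suc m) - 1) * (x $ j * Q x)
      = x $ j * ((\<Sum>i\<in>UNIV. x $ i * pd i Q x) - (real m - 1) * Q x)" for x
  proof -
    have "(\<Sum>i\<in>UNIV. x $ i * pd i (\<lambda>x. x $ j * Q x) x)
        = (\<Sum>i\<in>UNIV. (if i = j then x $ j * Q x else 0) + x $ j * (x $ i * pd i Q x))"
      by (intro sum.cong refl) (subst pd_coord_mult [OF coord.hyps], auto simp: algebra_simps)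
    also have "\<dots> = x $ j * Q x + x $ j * (\<Sum>i\<in>UNIV. x $ i * pd i Q x)"
      by (simp add: sum.distrib sum_distrib_left)
    finally show ?thesis by (simp add: algebra_simps)
  qed
  moreover have "poly_lt m (\<lambda>x. x $ j * ((\<Sum>i\<in>UNIV. x $ i * pd i Q x) - (real m - 1) * Q x))"
  proof (cases m)
    case 0
    then show ?thesis
      using poly_lt_0 [OF coord.hyps] poly_lt_0 [OF poly_lt_pd [OF coord.hyps]]
      by (auto intro: poly_lt.zero)
  next
    case (Suc k)
    then show ?thesis using poly_lt.coord [OF coord.IH, of j] by simp
  qed
  ultimately show ?case by simp
next
  case (lift m Q)
  \<comment> \<open>Raising the bound raises the factor by one; the extra \<open>Q\<close> already
    has degree below \<open>m\<close>.\<close>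
  have "poly_lt m (\<lambda>x. (\<Sum>i\<in>UNIV. x $ i * pd i Q x) - (real m - 1) * Q x - Q x)"
    by (rule poly_lt_diff [OF poly_lt_mono [OF lift.IH] lift.hyps]) simp
  then show ?case by (simp add: algebra_simps)
qed

text \<open>The operator \<open>\<Sum>\<^sub>i a\<^sub>i\<^sup>* a\<^sub>i\<close> seen on
  polynomial factors: \<open>a\<^sub>i\<close> sends \<open>Q g\<close> to
  \<open>(pd i Q) g\<close>, and its adjoint sends \<open>R g\<close> to
  \<open>(2 b x\<^sub>i R - pd i R) g\<close>.\<close>

definition number_op :: "real \<Rightarrow> (real^'n \<Rightarrow> real) \<Rightarrow> real^'n \<Rightarrow> real" where
  "number_op b Q x = (\<Sum>i\<in>UNIV. 2 * b * x $ i * pd i Q x - pd i (pd i Q) x)"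

text \<open>Second derivatives lower the degree, and the first-order term is \<open>2 * b\<close>
  times the Euler field; so \<open>2 * b * real m\<close> is the eigenvalue modulo lower
  degrees.\<close>

lemma poly_lt_number_op:
  assumes "poly_lt (Suc m) Q"
  shows "poly_lt m (\<lambda>x. number_op b Q x - 2 * b * real m * Q x)"
proof -
  have "poly_lt m (pd i (pd i Q))" for i
    using poly_lt_pd [OF poly_lt_pd [OF assms, of i], of i] by (rule poly_lt_mono) simp
  then have "poly_lt m (\<lambda>x. \<Sum>i\<in>UNIV. pd i (pd i Q) x)" by (intro poly_lt_sum)
  moreover have "poly_lt m (\<lambda>x. 2 * b * ((\<Sum>i\<in>UNIV. x $ i * pd i Q x) - real m * Q x))"
    using poly_lt_euler [OF assms] by (intro poly_lt_cmult) simp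
  ultimately have "poly_lt m (\<lambda>x. 2 * b * ((\<Sum>i\<in>UNIV. x $ i * pd i Q x) - real m * Q x)
      - (\<Sum>i\<in>UNIV. pd i (pd i Q) x))"
    by (rule poly_lt_diff [rotated])
  then show ?thesis
    by (simp add: number_op_def sum_subtractf sum_distrib_left algebra_simps)
qed

section \<open>Monomials as a finite spanning family\<close>

definition indices_lt :: "nat \<Rightarrow> ('n::finite \<Rightarrow> nat) set" where
  "indices_lt m = {\<alpha>. (\<Sum>i\<in>UNIV. \<alpha> i) < m}"

lemma indices_lt_Suc: "indices_lt (Suc m) = multi_indices m"
  by (simp add: indices_lt_def multi_indices_def less_Suc_eq_le)

lemma finite_indices_lt [simp]: "finite (indices_lt m)"
  by (rule finite_subset [OF _ finite_multi_indices [of m]]) (auto simp: indices_lt_def multi_indices_def)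

lemma monomial_upd: "monomial (\<alpha>(i := Suc (\<alpha> i))) x = x $ i * monomial \<alpha> x"
proof -
  have "(x $ k) ^ (\<alpha>(i := Suc (\<alpha> i))) k = (if k = i then x $ i else 1) * (x $ k) ^ \<alpha> k" for k
    by auto
  then show ?thesis by (simp add: monomial_def prod.distrib)
qed

lemma sum_upd_Suc: "(\<Sum>k\<in>UNIV. (\<alpha>(i := Suc (\<alpha> i))) k) = Suc (\<Sum>k\<in>UNIV. \<alpha> k)" for \<alpha> :: "'n::finite \<Rightarrow> nat"
proof -
  have "(\<alpha>(i := Suc (\<alpha> i))) k = (if k = i then 1 else 0) + \<alpha> k" for k by simp
  then show ?thesis by (simp add: sum.distrib)
qed

lemma poly_lt_monomial: "(\<Sum>i\<in>UNIV. \<alpha> i) < m \<Longrightarrow> poly_lt m (monomial \<alpha>)"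
proof (induction m arbitrary: \<alpha>)
  case (Suc m)
  show ?case
  proof (cases "\<forall>i. \<alpha> i = 0")
    case True
    then have "monomial \<alpha> = (\<lambda>_. 1)" by (simp add: monomial_def fun_eq_iff)
    then show ?thesis by (auto intro: poly_lt.const)
  next
    case False
    then obtain i where i: "\<alpha> i > 0" by auto
    define \<beta> where "\<beta> = \<alpha>(i := \<alpha> i - 1)"
    have \<alpha>: "\<alpha> = \<beta>(i := Suc (\<beta> i))" using i by (auto simp: \<beta>_def)
    have "poly_lt m (monomial \<beta>)"
      using Suc.prems sum_upd_Suc [of \<beta> i] \<alpha> by (intro Suc.IH) simp
    moreover have "monomial \<alpha> = (\<lambda>x. x $ i * monomial \<beta> x)"
      by (rule ext, subst \<alpha>, rule monomial_upd)
    ultimately show ?thesis by (simp add: poly_lt.coord)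
  qed
qed simp

text \<open>Turns the inductive notion into finite linear combinations. This makes projections
  finite-dimensional and links \<open>poly_lt\<close> to \<open>polys_le\<close>.\<close>

lemma poly_lt_expand:
  assumes "poly_lt m Q"
  shows "\<exists>c. Q = (\<lambda>x. \<Sum>\<alpha>\<in>indices_lt m. c \<alpha> * monomial \<alpha> x)"
  using assms
proof (induction rule: poly_lt.induct)
  case (zero m)
  show ?case by (rule exI [of _ "\<lambda>_. 0"]) simp
next
  case (const m c)
  have "c = (\<Sum>\<alpha>\<in>indices_lt (Suc m). (if \<alpha> = (\<lambda>_. 0) then c else 0) * monomial \<alpha> x)" for x :: "real^'a"
  proof -
    have "(\<Sum>\<alpha>\<in>indices_lt (Suc m). (if \<alpha> = (\<lambda>_. 0) then c else 0) * monomial \<alpha> x)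
        = (\<Sum>\<alpha>\<in>indices_lt (Suc m). if \<alpha> = (\<lambda>_::'a. 0) then c else 0)"
      by (intro sum.cong refl) (auto simp: monomial_def)
    also have "\<dots> = c" by (subst sum.delta [OF finite_indices_lt]) (simp add: indices_lt_def)
    finally show ?thesis by simp
  qed
  then show ?case by (intro exI [of _ "\<lambda>\<alpha>. if \<alpha> = (\<lambda>_. 0) then c else 0"]) (simp add: fun_eq_iff)
next
  case (add m P Q)
  then obtain c d where "P = (\<lambda>x. \<Sum>\<alpha>\<in>indices_lt m. c \<alpha> * monomial \<alpha> x)"
    "Q = (\<lambda>x. \<Sum>\<alpha>\<in>indices_lt m. d \<alpha> * monomial \<alpha> x)" by blast
  then show ?case
    by (intro exI [of _ "\<lambda>\<alpha>. c \<alpha> + d \<alpha>"]) (simp add: fun_eq_iff distrib_right sum.distrib)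
next
  case (coord m Q i)
  then obtain c where c: "Q = (\<lambda>x. \<Sum>\<alpha>\<in>indices_lt m. c \<alpha> * monomial \<alpha> x)" by blast
  \<comment> \<open>Multiplication by \<open>x $ i\<close> shifts exponents by the injective map
    \<open>\<phi>\<close>; coefficients are carried back along its inverse and are zero off its
    image.\<close>
  define \<phi> where "\<phi> \<alpha> = \<alpha>(i := Suc (\<alpha> i))" for \<alpha> :: "'a \<Rightarrow> nat"
  have inj: "inj \<phi>" by (rule injI) (auto simp: \<phi>_def fun_eq_iff split: if_splits)
  have sub: "\<phi> ` indices_lt m \<subseteq> indices_lt (Suc m)"
    using sum_upd_Suc [of _ i] by (auto simp: indices_lt_def \<phi>_def simp del: fun_upd_apply)
  have m: "monomial (\<phi> \<alpha>) x = x $ i * monomial \<alpha> x" for \<alpha> x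
    unfolding \<phi>_def by (rule monomial_upd)
  define d where "d \<beta> = (if \<beta> \<in> \<phi> ` indices_lt m then c (inv \<phi> \<beta>) else 0)" for \<beta>
  have "x $ i * Q x = (\<Sum>\<beta>\<in>indices_lt (Suc m). d \<beta> * monomial \<beta> x)" for x
  proof -
    have "x $ i * Q x = (\<Sum>\<alpha>\<in>indices_lt m. d (\<phi> \<alpha>) * monomial (\<phi> \<alpha>) x)"
      unfolding c sum_distrib_left
      by (intro sum.cong refl) (simp add: d_def inv_f_f [OF inj] m)
    also have "\<dots> = (\<Sum>\<beta>\<in>\<phi> ` indices_lt m. d \<beta> * monomial \<beta> x)"
      using inj by (simp add: sum.reindex inj_on_subset [OF inj])
    also have "\<dots> = (\<Sum>\<beta>\<in>indices_lt (Suc m). d \<beta> * monomial \<beta> x)"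
      using sub by (intro sum.mono_neutral_left) (auto simp: d_def)
    finally show ?thesis .
  qed
  then show ?case by blast
next
  case (lift m Q)
  then obtain c where c: "Q = (\<lambda>x. \<Sum>\<alpha>\<in>indices_lt m. c \<alpha> * monomial \<alpha> x)" by blast
  have "Q x = (\<Sum>\<alpha>\<in>indices_lt (Suc m). (if \<alpha> \<in> indices_lt m then c \<alpha> else 0) * monomial \<alpha> x)" for x
    unfolding c by (rule sum.mono_neutral_cong_left [OF finite_indices_lt]) (auto simp: indices_lt_def)
  then show ?case
    by (intro exI [of _ "\<lambda>\<alpha>. if \<alpha> \<in> indices_lt m then c \<alpha> else 0"] ext)
qed

section \<open>Inner products and orthogonal projections\<close>

abbreviation (input) ip :: "('a::euclidean_space \<Rightarrow> real) \<Rightarrow> ('a \<Rightarrow> real) \<Rightarrow> real" where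
  "ip f g \<equiv> (\<integral>x. f x * g x \<partial>lborel)"

lemma ip_integrable: "gauss_decay f \<Longrightarrow> gauss_decay g \<Longrightarrow> integrable lborel (\<lambda>x. f x * g x)"
  by (intro gauss_decay_integrable gauss_decay_mult)

lemma ip_add:
  "gauss_decay f \<Longrightarrow> gauss_decay g \<Longrightarrow> gauss_decay h \<Longrightarrow> ip (\<lambda>x. f x + g x) h = ip f h + ip g h"
  by (simp add: distrib_right ip_integrable)

lemma ip_diff:
  "gauss_decay f \<Longrightarrow> gauss_decay g \<Longrightarrow> gauss_decay h \<Longrightarrow> ip (\<lambda>x. f x - g x) h = ip f h - ip g h"
  by (simp add: left_diff_distrib ip_integrable)

lemma ip_cmult: "ip (\<lambda>x. c * f x) h = c * ip f h"
  by (simp add: mult.assoc)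

lemma ip_sum:
  "(\<And>i. i \<in> I \<Longrightarrow> gauss_decay (f i)) \<Longrightarrow> gauss_decay h \<Longrightarrow>
    ip (\<lambda>x. \<Sum>i\<in>I. f i x) h = (\<Sum>i\<in>I. ip (f i) h)"
  by (simp add: sum_distrib_right ip_integrable)

lemma ip_commute: "ip f g = ip g f"
  by (simp add: mult.commute)

text \<open>Covers the degenerate case of Gram-Schmidt: a residual of norm zero vanishes almost
  everywhere.\<close>

lemma ip_self_eq_0:
  assumes "gauss_decay e" "gauss_decay f" "ip e e = 0"
  shows "ip f e = 0"
proof -
  have "AE x in lborel. e x * e x = 0"
    using assms by (subst integral_nonneg_eq_0_iff_AE [symmetric]) (auto intro: ip_integrable)
  then have "AE x in lborel. f x * e x = 0" by eventually_elim simp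
  then show ?thesis by (rule integral_eq_zero_AE)
qed

text \<open>Gram-Schmidt, adding one function at a time; the family may be linearly
  dependent.\<close>

lemma orthogonal_projection_span:
  assumes "finite I" "\<And>i. i \<in> I \<Longrightarrow> gauss_decay (h i)" "gauss_decay f"
  shows "\<exists>c. \<forall>j\<in>I. ip (\<lambda>x. f x - (\<Sum>i\<in>I. c i * h i x)) (h j) = 0"
  using assms
proof (induction I arbitrary: f)
  case (insert a F)
  have h: "\<And>i. i \<in> F \<Longrightarrow> gauss_decay (h i)" and ha: "gauss_decay (h a)" and f: "gauss_decay f"
    using insert.prems by auto
  obtain c where c: "\<And>j. j \<in> F \<Longrightarrow> ip (\<lambda>x. f x - (\<Sum>i\<in>F. c i * h i x)) (h j) = 0"
    using insert.IH [OF h f] by blast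
  obtain d where d: "\<And>j. j \<in> F \<Longrightarrow> ip (\<lambda>x. h a x - (\<Sum>i\<in>F. d i * h i x)) (h j) = 0"
    using insert.IH [OF h ha] by blast
  \<comment> \<open>Relative to the span over \<open>F\<close>, \<open>r\<close> is the residual of
    \<open>f\<close>, \<open>s\<close> the projection of \<open>h a\<close> and \<open>e\<close> the
    residual of \<open>h a\<close>. The new residual is \<open>r - k * e\<close>.\<close>
  define r where "r = (\<lambda>x. f x - (\<Sum>i\<in>F. c i * h i x))"
  define s where "s = (\<lambda>x. \<Sum>i\<in>F. d i * h i x)"
  define e where "e = (\<lambda>x. h a x - s x)"
  \<comment> \<open>If \<open>ip e e = 0\<close>, division by zero gives \<open>k = 0\<close>, and
    \<open>ip r e = 0\<close> then comes from \<open>ip_self_eq_0\<close>.\<close>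
  define k where "k = ip r e / ip e e"
  have s: "gauss_decay s" and r: "gauss_decay r" and e: "gauss_decay e"
    unfolding s_def r_def e_def
    by (intro gauss_decay_diff gauss_decay_sum gauss_decay_cmult h ha f; assumption)+
  have c0: "ip r (h j) = 0" and d0: "ip e (h j) = 0" if "j \<in> F" for j
    using c [OF that] d [OF that] by (simp_all add: r_def e_def s_def)
  have p: "gauss_decay (\<lambda>x. r x - k * e x)" by (intro gauss_decay_diff gauss_decay_cmult r e)
  have pF: "ip (\<lambda>x. r x - k * e x) (h j) = 0" if "j \<in> F" for j
    using that by (simp add: ip_diff r gauss_decay_cmult e h ip_cmult c0 d0)
  have "ip s (\<lambda>x. r x - k * e x) = (\<Sum>i\<in>F. ip (\<lambda>x. d i * h i x) (\<lambda>x. r x - k * e x))"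
    unfolding s_def by (intro ip_sum p gauss_decay_cmult h)
  also have "\<dots> = 0"
    using pF by (intro sum.neutral ballI) (simp add: ip_cmult ip_commute [of "h _"])
  finally have ps: "ip (\<lambda>x. r x - k * e x) s = 0" by (simp add: mult.commute)
  have pe: "ip (\<lambda>x. r x - k * e x) e = 0"
    using ip_self_eq_0 [OF e r]
    by (simp add: ip_diff r gauss_decay_cmult e ip_cmult) (auto simp: k_def)
  have "h a = (\<lambda>x. e x + s x)" by (simp add: e_def)
  then have pa: "ip (\<lambda>x. r x - k * e x) (h a) = 0"
    using ps pe by (simp add: ip_commute [of "\<lambda>x. r x - k * e x"] ip_add e s p)
  define c' where "c' i = (if i = a then k else c i - k * d i)" for i
  have "f x - (\<Sum>i\<in>insert a F. c' i * h i x) = r x - k * e x" for x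
  proof -
    have "(\<Sum>i\<in>F. c' i * h i x) = (\<Sum>i\<in>F. c i * h i x - k * (d i * h i x))"
      using insert.hyps by (intro sum.cong refl) (auto simp: c'_def algebra_simps)
    also have "\<dots> = (\<Sum>i\<in>F. c i * h i x) - k * s x"
      by (simp add: sum_subtractf sum_distrib_left s_def)
    finally show ?thesis using insert.hyps by (simp add: c'_def r_def e_def algebra_simps)
  qed
  then show ?case using pF pa by (intro exI [of _ c']) auto
qed simp

text \<open>Orthogonality to the monomials extends to all polynomials by
  \<open>poly_lt_expand\<close> and linearity.\<close>

lemma orthogonal_projection_poly:
  assumes f: "gauss_decay f" and t: "t > 0"
  obtains Q where "poly_lt m Q"
    "\<And>R. poly_lt m R \<Longrightarrow> ip (\<lambda>x. f x - Q x * gauss t x) (\<lambda>x. R x * gauss t x) = 0"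
proof -
  let ?h = "\<lambda>\<alpha> x. monomial \<alpha> x * gauss t x"
  have h: "gauss_decay (?h \<alpha>)" if "\<alpha> \<in> indices_lt m" for \<alpha>
    using that by (intro gauss_decay_poly [OF _ t] poly_lt_monomial) (simp add: indices_lt_def)
  obtain c where c: "\<And>\<beta>. \<beta> \<in> indices_lt m \<Longrightarrow>
      ip (\<lambda>x. f x - (\<Sum>\<alpha>\<in>indices_lt m. c \<alpha> * ?h \<alpha> x)) (?h \<beta>) = 0"
    using orthogonal_projection_span [of "indices_lt m" ?h f, OF finite_indices_lt h f] by blast
  define Q where "Q = (\<lambda>x. \<Sum>\<alpha>\<in>indices_lt m. c \<alpha> * monomial \<alpha> x)"
  have Q: "poly_lt m Q"
    unfolding Q_def by (intro poly_lt_sum poly_lt_cmult poly_lt_monomial) (simp add: indices_lt_def)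
  have eq: "f x - (\<Sum>\<alpha>\<in>indices_lt m. c \<alpha> * ?h \<alpha> x) = f x - Q x * gauss t x" for x
    by (simp add: Q_def sum_distrib_right mult.assoc)
  have p: "gauss_decay (\<lambda>x. f x - Q x * gauss t x)"
    by (intro gauss_decay_diff f gauss_decay_poly [OF Q t])
  show ?thesis
  proof (rule that [OF Q])
    fix R :: "real^'a \<Rightarrow> real"
    assume "poly_lt m R"
    then obtain d where d: "R = (\<lambda>x. \<Sum>\<beta>\<in>indices_lt m. d \<beta> * monomial \<beta> x)"
      using poly_lt_expand by blast
    have "ip (\<lambda>x. R x * gauss t x) (\<lambda>x. f x - Q x * gauss t x)
        = ip (\<lambda>x. \<Sum>\<beta>\<in>indices_lt m. d \<beta> * ?h \<beta> x) (\<lambda>x. f x - Q x * gauss t x)"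
      by (simp add: d sum_distrib_right mult.assoc)
    also have "\<dots> = (\<Sum>\<beta>\<in>indices_lt m. ip (\<lambda>x. d \<beta> * ?h \<beta> x) (\<lambda>x. f x - Q x * gauss t x))"
      by (intro ip_sum p gauss_decay_cmult h)
    also have "\<dots> = 0"
    proof (intro sum.neutral ballI)
      fix \<beta> :: "'a \<Rightarrow> nat" assume "\<beta> \<in> indices_lt m"
      from c [OF this, unfolded eq]
      show "ip (\<lambda>x. d \<beta> * ?h \<beta> x) (\<lambda>x. f x - Q x * gauss t x) = 0"
        unfolding ip_cmult by (subst ip_commute) simp
    qed
    finally show "ip (\<lambda>x. f x - Q x * gauss t x) (\<lambda>x. R x * gauss t x) = 0"
      by (subst ip_commute)
  qed
qed

section \<open>The number operator\<close>

lemma has_partial_poly_gauss: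
  assumes "poly_lt m Q"
  shows "has_partial i (\<lambda>x. Q x * gauss (b / 2) x) (\<lambda>x. (pd i Q x - b * x $ i * Q x) * gauss (b / 2) x)"
  using has_partial_mult [OF has_partial_poly_pd [OF assms, of i] has_partial_gauss [of i "b / 2"]]
  by (simp add: algebra_simps)

text \<open>The operator is the adjoint of \<open>a\<^sub>i\<close>, the creation operator, on
  polynomial factors.\<close>

lemma poly_lt_creation:
  assumes "poly_lt m R" shows "poly_lt (Suc m) (\<lambda>x. 2 * b * x $ i * R x - pd i R x)"
proof -
  have "poly_lt (Suc m) (\<lambda>x. 2 * b * (x $ i * R x))"
    by (intro poly_lt_cmult poly_lt.coord assms)
  moreover have "poly_lt (Suc m) (pd i R)" by (rule poly_lt_mono [OF poly_lt_pd [OF assms]]) simp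
  ultimately show ?thesis using poly_lt_diff by (fastforce simp: mult.assoc)
qed

text \<open>Integration by parts moves \<open>a\<^sub>i\<close> to the other side as
  \<open>- \<partial>\<^sub>i + b x\<^sub>i\<close>; differentiating the Gaussian contributes a
  second \<open>b x\<^sub>i\<close>, hence the factor 2.\<close>

lemma annihilation_adjoint:
  assumes hp: "has_partial i f f'" and f: "gauss_decay f" and f': "gauss_decay f'"
    and R: "poly_lt m R" and b: "b > 0"
  shows "ip (\<lambda>x. f' x + b * (x $ i * f x)) (\<lambda>x. R x * gauss (b / 2) x)
       = ip f (\<lambda>x. (2 * b * x $ i * R x - pd i R x) * gauss (b / 2) x)"
proof -
  let ?g = "gauss (b / 2) :: real^'a \<Rightarrow> real"
  have g: "gauss_decay (\<lambda>x. P x * ?g x)" if "poly_lt k P" for k P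
    using that b by (intro gauss_decay_poly) auto
  have 1: "gauss_decay (\<lambda>x. R x * ?g x)" by (rule g [OF R])
  have xR: "gauss_decay (\<lambda>x. b * (x $ i * R x) * ?g x)"
    by (rule g [OF poly_lt_cmult [OF poly_lt.coord [OF R]]])
  have "gauss_decay (\<lambda>x. pd i R x * ?g x - b * (x $ i * R x) * ?g x)"
    by (intro gauss_decay_diff xR g [OF poly_lt_pd [OF R]])
  then have 2: "gauss_decay (\<lambda>x. (pd i R x - b * x $ i * R x) * ?g x)"
    by (simp add: algebra_simps)
  have xf: "gauss_decay (\<lambda>x. b * (x $ i * f x))"
    by (intro gauss_decay_cmult gauss_decay_coord f)
  have 3: "gauss_decay (\<lambda>x. (b * x $ i * R x) * ?g x)" using xR by (simp add: mult.assoc)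
  have "ip (\<lambda>x. f' x + b * (x $ i * f x)) (\<lambda>x. R x * ?g x)
      = ip f' (\<lambda>x. R x * ?g x) + ip (\<lambda>x. b * (x $ i * f x)) (\<lambda>x. R x * ?g x)"
    by (rule ip_add [OF f' xf 1])
  also have "ip f' (\<lambda>x. R x * ?g x) = - ip f (\<lambda>x. (pd i R x - b * x $ i * R x) * ?g x)"
    by (rule integral_by_parts_partial [OF hp has_partial_poly_gauss [OF R] f f' 1 2])
  also have "ip (\<lambda>x. b * (x $ i * f x)) (\<lambda>x. R x * ?g x) = ip f (\<lambda>x. (b * x $ i * R x) * ?g x)"
    by (intro Bochner_Integration.integral_cong refl) (simp add: mult_ac)
  also have "- ip f (\<lambda>x. (pd i R x - b * x $ i * R x) * ?g x) + ip f (\<lambda>x. (b * x $ i * R x) * ?g x)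
      = (\<integral>x. f x * ((b * x $ i * R x) * ?g x) - f x * ((pd i R x - b * x $ i * R x) * ?g x) \<partial>lborel)"
    by (subst Bochner_Integration.integral_diff) (simp_all add: ip_integrable f 2 3)
  also have "\<dots> = ip f (\<lambda>x. (2 * b * x $ i * R x - pd i R x) * ?g x)"
    by (intro Bochner_Integration.integral_cong refl) (simp add: algebra_simps)
  finally show ?thesis .
qed

text \<open>Since \<open>a\<^sub>i\<close> annihilates the Gaussian \<open>g\<close>, it maps
  \<open>Q g\<close> to \<open>(pd i Q) g\<close>; so this is the sum over \<open>i\<close> of the
  inner products of \<open>a\<^sub>i (Q g)\<close> and \<open>a\<^sub>i (R g)\<close>.\<close>

definition energy :: "real \<Rightarrow> (real^'n \<Rightarrow> real) \<Rightarrow> (real^'n \<Rightarrow> real) \<Rightarrow> real" where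
  "energy b Q R = (\<Sum>i\<in>UNIV. ip (\<lambda>x. pd i Q x * gauss (b / 2) x) (\<lambda>x. pd i R x * gauss (b / 2) x))"

lemma energy_commute: "energy b Q R = energy b R Q"
  by (simp add: energy_def mult.commute)

lemma energy_number_op:
  assumes Q: "poly_lt m Q" and R: "poly_lt n R" and b: "b > 0"
  shows "energy b Q R = ip (\<lambda>x. Q x * gauss (b / 2) x) (\<lambda>x. number_op b R x * gauss (b / 2) x)"
proof -
  let ?g = "gauss (b / 2) :: real^'a \<Rightarrow> real"
  have g: "gauss_decay (\<lambda>x. P x * ?g x)" if "poly_lt k P" for k P
    using that b by (intro gauss_decay_poly) auto
  have *: "ip (\<lambda>x. pd i Q x * ?g x) (\<lambda>x. pd i R x * ?g x)
      = ip (\<lambda>x. (2 * b * x $ i * pd i R x - pd i (pd i R) x) * ?g x) (\<lambda>x. Q x * ?g x)" for i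
  proof -
    \<comment> \<open>This is \<open>a\<^sub>i (Q g) = (pd i Q) g\<close>: the two terms with
      \<open>b\<close> cancel.\<close>
    have eq: "(pd i Q x - b * x $ i * Q x) * ?g x + b * (x $ i * (Q x * ?g x)) = pd i Q x * ?g x" for x
      by (simp add: algebra_simps)
    have "gauss_decay (\<lambda>x. pd i Q x * ?g x - b * (x $ i * (Q x * ?g x)))"
      by (intro gauss_decay_diff gauss_decay_cmult gauss_decay_coord g [OF Q] g [OF poly_lt_pd [OF Q]])
    then have "gauss_decay (\<lambda>x. (pd i Q x - b * x $ i * Q x) * ?g x)" by (simp add: algebra_simps)
    from annihilation_adjoint [OF has_partial_poly_gauss [OF Q] g [OF Q] this poly_lt_pd [OF R, of i] b]
    have "ip (\<lambda>x. pd i Q x * ?g x) (\<lambda>x. pd i R x * ?g x)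
        = ip (\<lambda>x. Q x * ?g x) (\<lambda>x. (2 * b * x $ i * pd i R x - pd i (pd i R) x) * ?g x)"
      by (simp only: eq)
    then show ?thesis by (rule trans [OF _ ip_commute])
  qed
  have "energy b Q R
      = ip (\<lambda>x. \<Sum>i\<in>UNIV. (2 * b * x $ i * pd i R x - pd i (pd i R) x) * ?g x) (\<lambda>x. Q x * ?g x)"
    unfolding energy_def *
    by (intro ip_sum [symmetric] g [OF Q] g [OF poly_lt_creation [OF poly_lt_pd [OF R]]])
  also have "\<dots> = ip (\<lambda>x. number_op b R x * ?g x) (\<lambda>x. Q x * ?g x)"
    by (simp add: number_op_def sum_distrib_right)
  finally show ?thesis by (subst ip_commute)
qed

lemma energy_add:
  assumes P: "poly_lt m P" and Q: "poly_lt n Q" and b: "b > 0"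
  shows "energy b (\<lambda>x. P x + Q x) (\<lambda>x. P x + Q x) = energy b P P + 2 * energy b P Q + energy b Q Q"
proof -
  let ?g = "gauss (b / 2) :: real^'a \<Rightarrow> real"
  have g: "gauss_decay (\<lambda>x. pd i P x * ?g x)" "gauss_decay (\<lambda>x. pd i Q x * ?g x)" for i
    using b by (auto intro!: gauss_decay_poly poly_lt_pd P Q)
  have "ip (\<lambda>x. (pd i P x + pd i Q x) * ?g x) (\<lambda>x. (pd i P x + pd i Q x) * ?g x)
      = ip (\<lambda>x. pd i P x * ?g x) (\<lambda>x. pd i P x * ?g x)
        + 2 * ip (\<lambda>x. pd i P x * ?g x) (\<lambda>x. pd i Q x * ?g x)
        + ip (\<lambda>x. pd i Q x * ?g x) (\<lambda>x. pd i Q x * ?g x)" (is "_ = ?r") for i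
  proof -
    have "?r = (\<integral>x. (pd i P x * ?g x) * (pd i P x * ?g x)
        + 2 * ((pd i P x * ?g x) * (pd i Q x * ?g x)) + (pd i Q x * ?g x) * (pd i Q x * ?g x) \<partial>lborel)"
      using g [of i] by (simp add: ip_integrable)
    then show ?thesis by (simp add: algebra_simps)
  qed
  then show ?thesis by (simp add: energy_def pd_add [OF P Q] sum.distrib sum_distrib_left)
qed

lemma ip_pythagoras:
  assumes "gauss_decay f" "gauss_decay g" "ip f g = 0"
  shows "ip (\<lambda>x. f x + g x) (\<lambda>x. f x + g x) = ip f f + ip g g"
proof -
  have "ip f f + ip g g = (\<integral>x. f x * f x + 2 * (f x * g x) + g x * g x \<partial>lborel)"
    using assms by (simp add: ip_integrable)
  then show ?thesis by (simp add: algebra_simps)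
qed

text \<open>Peeling off the top degree: if \<open>e\<close> has degree \<open>m\<close> and is orthogonal to lower degrees, then
  the number operator maps \<open>e\<close> to \<open>2bm e\<close> modulo lower degrees.\<close>

lemma energy_poly:
  fixes Q :: "real^'n \<Rightarrow> real"
  assumes "poly_lt (Suc m) Q" "b > 0"
  shows "\<exists>W. (\<forall>j<m. poly_lt (Suc j) (W j)) \<and>
    energy b Q Q = 2 * b * (\<Sum>j<m. ip (\<lambda>x. (Q x - W j x) * gauss (b / 2) x)
                                      (\<lambda>x. (Q x - W j x) * gauss (b / 2) x))"
  using assms(1)
proof (induction m arbitrary: Q)
  case 0
  have "pd i Q = (\<lambda>_. 0)" for i using poly_lt_0 [OF poly_lt_pd [OF 0, of i]] by simp
  then show ?case by (simp add: energy_def)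
next
  case (Suc m)
  let ?g = "gauss (b / 2) :: real^'n \<Rightarrow> real"
  have g: "gauss_decay (\<lambda>x. P x * ?g x)" if "poly_lt k P" for k P
    using that \<open>b > 0\<close> by (intro gauss_decay_poly) auto
  obtain P where P: "poly_lt (Suc m) P"
    and orth: "\<And>R. poly_lt (Suc m) R \<Longrightarrow> ip (\<lambda>x. Q x * ?g x - P x * ?g x) (\<lambda>x. R x * ?g x) = 0"
    using orthogonal_projection_poly [OF g [OF Suc.prems], of "b / 2" "Suc m"] \<open>b > 0\<close> by auto
  define e where "e = (\<lambda>x. Q x - P x)"
  have e: "poly_lt (Suc (Suc m)) e"
    unfolding e_def by (intro poly_lt_diff Suc.prems poly_lt.lift P)
  have orth: "ip (\<lambda>x. e x * ?g x) (\<lambda>x. R x * ?g x) = 0" if "poly_lt (Suc m) R" for R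
    using orth [OF that] by (simp add: e_def left_diff_distrib)
  have Q: "Q = (\<lambda>x. P x + e x)" by (simp add: e_def)
  let ?E = "ip (\<lambda>x. e x * ?g x) (\<lambda>x. e x * ?g x)"
  have "energy b e e = 2 * b * real (Suc m) * ?E"
  proof -
    define S where "S = (\<lambda>x. number_op b e x - 2 * b * real (Suc m) * e x)"
    have S: "poly_lt (Suc m) S" unfolding S_def by (rule poly_lt_number_op [OF e])
    have "energy b e e = ip (\<lambda>x. number_op b e x * ?g x) (\<lambda>x. e x * ?g x)"
      by (subst energy_number_op [OF e e \<open>b > 0\<close>]) (rule ip_commute)
    also have "\<dots> = ip (\<lambda>x. S x * ?g x + (2 * b * real (Suc m)) * (e x * ?g x)) (\<lambda>x. e x * ?g x)"
      by (intro Bochner_Integration.integral_cong refl) (simp add: S_def algebra_simps)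
    also have "\<dots> = ip (\<lambda>x. S x * ?g x) (\<lambda>x. e x * ?g x) + 2 * b * real (Suc m) * ?E"
      by (simp only: ip_add [OF g [OF S] gauss_decay_cmult [OF g [OF e]] g [OF e]] ip_cmult)
    also have "ip (\<lambda>x. S x * ?g x) (\<lambda>x. e x * ?g x) = 0"
      using orth [OF S] by (subst ip_commute)
    finally show ?thesis by simp
  qed
  \<comment> \<open>The number operator preserves the degree bound \<open>Suc m\<close>, so
    \<open>e\<close> is orthogonal to \<open>number_op b P\<close>.\<close>
  moreover have "energy b P e = 0"
  proof -
    have "poly_lt (Suc m) (\<lambda>x. (number_op b P x - 2 * b * real m * P x) + 2 * b * real m * P x)"
      using poly_lt.lift [OF poly_lt_number_op [OF P, of b]] P
      by (intro poly_lt.add poly_lt_cmult) auto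
    then have "poly_lt (Suc m) (number_op b P)" by simp
    then show ?thesis
      by (subst energy_commute) (simp only: energy_number_op [OF e P \<open>b > 0\<close>] orth)
  qed
  ultimately have EQ: "energy b Q Q = energy b P P + 2 * b * real (Suc m) * ?E"
    unfolding Q using energy_add [OF P e \<open>b > 0\<close>] by simp
  obtain W where W: "\<forall>j<m. poly_lt (Suc j) (W j)"
    "energy b P P = 2 * b * (\<Sum>j<m. ip (\<lambda>x. (P x - W j x) * ?g x) (\<lambda>x. (P x - W j x) * ?g x))"
    using Suc.IH [OF P] by blast
  \<comment> \<open>The part \<open>e\<close> adds \<open>?E\<close> to the squared distance from
    \<open>Q\<close> to each of the \<open>m\<close> old \<open>W j\<close>, and \<open>?E\<close>
    is the squared distance to \<open>P\<close>. This makes \<open>Suc m\<close> copies, exactly the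
    coefficient in \<open>EQ\<close>.\<close>
  define W' where "W' j = (if j < m then W j else P)" for j
  have "ip (\<lambda>x. (Q x - W j x) * ?g x) (\<lambda>x. (Q x - W j x) * ?g x)
      = ?E + ip (\<lambda>x. (P x - W j x) * ?g x) (\<lambda>x. (P x - W j x) * ?g x)" if "j < m" for j
  proof -
    have "poly_lt (Suc m) (W j)" using W(1) that poly_lt_mono [of "Suc j" "W j" "Suc m"] by simp
    then have PW: "poly_lt (Suc m) (\<lambda>x. P x - W j x)" by (intro poly_lt_diff P)
    from ip_pythagoras [OF g [OF e] g [OF PW] orth [OF PW]]
    show ?thesis by (simp add: e_def algebra_simps)
  qed
  then have "(\<Sum>j<m. ip (\<lambda>x. (Q x - W' j x) * ?g x) (\<lambda>x. (Q x - W' j x) * ?g x))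
      = real m * ?E + (\<Sum>j<m. ip (\<lambda>x. (P x - W j x) * ?g x) (\<lambda>x. (P x - W j x) * ?g x))"
    by (simp add: W'_def sum.distrib)
  then have "energy b Q Q = 2 * b * (\<Sum>j<Suc m. ip (\<lambda>x. (Q x - W' j x) * ?g x) (\<lambda>x. (Q x - W' j x) * ?g x))"
    unfolding EQ W(2) by (simp add: W'_def e_def algebra_simps)
  moreover have "\<forall>j<Suc m. poly_lt (Suc j) (W' j)"
    using W(1) P by (auto simp: W'_def less_Suc_eq)
  ultimately show ?case by blast
qed

text \<open>The residual \<open>h\<close> of the projection is orthogonal to degrees at most
  \<open>m\<close>. Passing to the adjoint, \<open>a\<^sub>i h\<close> is orthogonal to
  \<open>a\<^sub>i (Q g)\<close>, and Pythagoras gives the estimate coordinate by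
  coordinate.\<close>

lemma energy_projection_le:
  assumes hp: "\<And>i. has_partial i f (f' i)" and f: "gauss_decay f" and f': "\<And>i. gauss_decay (f' i)"
    and b: "b > 0" and Q: "poly_lt (Suc m) Q"
    and orth: "\<And>R. poly_lt (Suc m) R \<Longrightarrow>
      ip (\<lambda>x. f x - Q x * gauss (b / 2) x) (\<lambda>x. R x * gauss (b / 2) x) = 0"
  shows "energy b Q Q \<le> (\<Sum>i\<in>UNIV. ip (\<lambda>x. f' i x + b * (x $ i * f x)) (\<lambda>x. f' i x + b * (x $ i * f x)))"
  unfolding energy_def
proof (rule sum_mono)
  fix i :: 'a
  let ?g = "gauss (b / 2) :: real^'a \<Rightarrow> real"
  have g: "gauss_decay (\<lambda>x. P x * ?g x)" if "poly_lt k P" for k P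
    using that b by (intro gauss_decay_poly) auto
  define h where "h = (\<lambda>x. f x - Q x * ?g x)"
  define h' where "h' = (\<lambda>x. f' i x - (pd i Q x - b * x $ i * Q x) * ?g x)"
  define e where "e = (\<lambda>x. pd i Q x * ?g x)"
  define r where "r = (\<lambda>x. h' x + b * (x $ i * h x))"
  have "has_partial i h h'"
    unfolding h_def h'_def by (intro has_partial_diff hp has_partial_poly_gauss [OF Q])
  moreover have h: "gauss_decay h" unfolding h_def by (intro gauss_decay_diff f g [OF Q])
  moreover have h': "gauss_decay h'"
  proof -
    have "gauss_decay (\<lambda>x. f' i x - (pd i Q x * ?g x - b * (x $ i * (Q x * ?g x))))"
      by (intro gauss_decay_diff f' gauss_decay_cmult gauss_decay_coord g [OF Q] g [OF poly_lt_pd [OF Q]])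
    then show ?thesis by (simp add: h'_def algebra_simps)
  qed
  ultimately have "ip r e = ip h (\<lambda>x. (2 * b * x $ i * pd i Q x - pd i (pd i Q) x) * ?g x)"
    unfolding r_def e_def by (rule annihilation_adjoint [OF _ _ _ poly_lt_pd [OF Q] b])
  \<comment> \<open>Differentiation lowers the bound to \<open>m\<close> and creation raises it back
    to \<open>Suc m\<close>, just within the range of \<open>orth\<close>.\<close>
  also have "\<dots> = 0"
    unfolding h_def using poly_lt_creation [OF poly_lt_pd [OF Q]] by (intro orth) simp
  finally have 0: "ip r e = 0" .
  have r: "gauss_decay r" unfolding r_def
    by (intro gauss_decay_add gauss_decay_cmult gauss_decay_coord h h')
  have e: "gauss_decay e" unfolding e_def by (rule g [OF poly_lt_pd [OF Q]])
  have eq: "f' i x + b * (x $ i * f x) = r x + e x" for x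
    by (simp add: r_def e_def h_def h'_def algebra_simps)
  have "ip e e \<le> ip r r + ip e e" by simp
  then show "ip (\<lambda>x. pd i Q x * ?g x) (\<lambda>x. pd i Q x * ?g x)
      \<le> ip (\<lambda>x. f' i x + b * (x $ i * f x)) (\<lambda>x. f' i x + b * (x $ i * f x))"
    unfolding eq ip_pythagoras [OF r e 0] unfolding e_def .
qed

definition poly_approx :: "real \<Rightarrow> (real^'n \<Rightarrow> real) \<Rightarrow> bool" where
  "poly_approx t f \<longleftrightarrow> gauss_decay f \<and> (\<forall>\<epsilon>>0. \<exists>m Q. poly_lt m Q \<and>
     ip (\<lambda>x. f x - Q x * gauss t x) (\<lambda>x. f x - Q x * gauss t x) < \<epsilon>)"

text \<open>The projection \<open>Q\<close> of \<open>f\<close> onto a large degree satisfies the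
  identity of \<open>energy_poly\<close>, and its energy is controlled by \<open>f\<close>. Passing
  from \<open>Q\<close> to \<open>f\<close> costs \<open>ip r r\<close> in each of \<open>J\<close>
  summands, which density makes small.\<close>

lemma spectral_estimate:
  fixes f :: "real^'n \<Rightarrow> real"
  assumes hp: "\<And>i. has_partial i f (f' i)" and f': "\<And>i. gauss_decay (f' i)"
    and b: "b > 0" and f: "poly_approx (b / 2) f" and \<eta>: "\<eta> > 0"
  shows "\<exists>W. (\<forall>j<J. poly_lt (Suc j) (W j)) \<and>
    2 * b * (\<Sum>j<J. ip (\<lambda>x. f x - W j x * gauss (b / 2) x) (\<lambda>x. f x - W j x * gauss (b / 2) x))
    \<le> (\<Sum>i\<in>UNIV. ip (\<lambda>x. f' i x + b * (x $ i * f x)) (\<lambda>x. f' i x + b * (x $ i * f x))) + \<eta>"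
proof -
  let ?g = "gauss (b / 2) :: real^'n \<Rightarrow> real"
  have g: "gauss_decay (\<lambda>x. P x * ?g x)" if "poly_lt k P" for k P
    using that b by (intro gauss_decay_poly) auto
  have fd: "gauss_decay f" using f by (simp add: poly_approx_def)
  \<comment> \<open>Each of the \<open>J\<close> summands costs at most
    \<open>2 * b * \<epsilon>\<close>; the \<open>+ 1\<close> keeps the denominator positive for
    \<open>J = 0\<close>.\<close>
  define \<epsilon> where "\<epsilon> = \<eta> / (2 * b * (real J + 1))"
  have \<epsilon>: "\<epsilon> > 0" using b \<eta> by (simp add: \<epsilon>_def)
  obtain n R where R: "poly_lt n R" "ip (\<lambda>x. f x - R x * ?g x) (\<lambda>x. f x - R x * ?g x) < \<epsilon>"
    using f \<epsilon> unfolding poly_approx_def by blast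
  \<comment> \<open>\<open>m \<ge> n\<close> makes the projection at least as close to
    \<open>f\<close> as \<open>R\<close>; \<open>m \<ge> J\<close> provides a \<open>W j\<close> for
    every \<open>j < J\<close>.\<close>
  define m where "m = max n J"
  obtain Q where Q: "poly_lt (Suc m) Q" and
    orth: "\<And>R. poly_lt (Suc m) R \<Longrightarrow> ip (\<lambda>x. f x - Q x * ?g x) (\<lambda>x. R x * ?g x) = 0"
    using orthogonal_projection_poly [OF fd, of "b / 2" "Suc m"] b by auto
  define r where "r = (\<lambda>x. f x - Q x * ?g x)"
  have r: "gauss_decay r" unfolding r_def by (intro gauss_decay_diff fd g [OF Q])
  have pyth: "ip (\<lambda>x. f x - P x * ?g x) (\<lambda>x. f x - P x * ?g x)
      = ip r r + ip (\<lambda>x. (Q x - P x) * ?g x) (\<lambda>x. (Q x - P x) * ?g x)" if "poly_lt (Suc m) P" for P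
  proof -
    have QP: "poly_lt (Suc m) (\<lambda>x. Q x - P x)" by (intro poly_lt_diff Q that)
    have "ip r (\<lambda>x. (Q x - P x) * ?g x) = 0" unfolding r_def by (rule orth [OF QP])
    moreover have "f x - P x * ?g x = r x + (Q x - P x) * ?g x" for x
      by (simp add: r_def algebra_simps)
    ultimately show ?thesis using ip_pythagoras [OF r g [OF QP]] by simp
  qed
  have "ip r r \<le> ip (\<lambda>x. f x - R x * ?g x) (\<lambda>x. f x - R x * ?g x)"
    using pyth [OF poly_lt_mono [OF R(1)]] by (simp add: m_def)
  then have rr: "ip r r < \<epsilon>" using R(2) by simp
  obtain W where W: "\<forall>j<m. poly_lt (Suc j) (W j)"
    "energy b Q Q = 2 * b * (\<Sum>j<m. ip (\<lambda>x. (Q x - W j x) * ?g x) (\<lambda>x. (Q x - W j x) * ?g x))"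
    using energy_poly [OF Q b] by blast
  have "(\<Sum>j<J. ip (\<lambda>x. f x - W j x * ?g x) (\<lambda>x. f x - W j x * ?g x))
      = (\<Sum>j<J. ip r r + ip (\<lambda>x. (Q x - W j x) * ?g x) (\<lambda>x. (Q x - W j x) * ?g x))"
  proof (intro sum.cong refl pyth)
    fix j assume "j \<in> {..<J}"
    then have "j < m" by (simp add: m_def)
    then show "poly_lt (Suc m) (W j)" using W(1) poly_lt_mono [of "Suc j" "W j" "Suc m"] by simp
  qed
  \<comment> \<open>The summands with \<open>J \<le> j < m\<close> are nonnegative and may be
    added.\<close>
  also have "\<dots> \<le> real J * \<epsilon> + (\<Sum>j<m. ip (\<lambda>x. (Q x - W j x) * ?g x) (\<lambda>x. (Q x - W j x) * ?g x))"
    unfolding sum.distrib using rr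
    by (intro add_mono sum_mono2) (auto simp: m_def mult_left_mono)
  finally have "2 * b * (\<Sum>j<J. ip (\<lambda>x. f x - W j x * ?g x) (\<lambda>x. f x - W j x * ?g x))
      \<le> 2 * b * (real J * \<epsilon> + (\<Sum>j<m. ip (\<lambda>x. (Q x - W j x) * ?g x) (\<lambda>x. (Q x - W j x) * ?g x)))"
    using b by (intro mult_left_mono) auto
  also have "\<dots> = 2 * b * real J * \<epsilon> + energy b Q Q" by (simp add: W(2) algebra_simps)
  also have "2 * b * real J * \<epsilon> \<le> \<eta>"
  proof -
    have "2 * b * real J * \<epsilon> \<le> 2 * b * (real J + 1) * \<epsilon>"
      using b \<epsilon> by (intro mult_right_mono) auto
    also have "\<dots> = \<eta>" using b by (simp add: \<epsilon>_def add_eq_0_iff)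
    finally show ?thesis .
  qed
  also have "energy b Q Q \<le> (\<Sum>i\<in>UNIV. ip (\<lambda>x. f' i x + b * (x $ i * f x)) (\<lambda>x. f' i x + b * (x $ i * f x)))"
    by (rule energy_projection_le [OF hp fd f' b Q orth])
  finally show ?thesis using W(1) by (intro exI [of _ W]) (auto simp: m_def)
qed

section \<open>Density of polynomials times a Gaussian\<close>

text \<open>Stands in for the triangle inequality while staying with squared distances; its factor 2
  is the reason for the \<open>\<epsilon> / 4\<close> below.\<close>

lemma ip_add_self_le:
  assumes "gauss_decay f" "gauss_decay g"
  shows "ip (\<lambda>x. f x + g x) (\<lambda>x. f x + g x) \<le> 2 * ip f f + 2 * ip g g"
proof -
  have "ip (\<lambda>x. f x + g x) (\<lambda>x. f x + g x) \<le> (\<integral>x. 2 * (f x * f x) + 2 * (g x * g x) \<partial>lborel)"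
  proof (rule integral_mono)
    fix x :: 'a
    show "(f x + g x) * (f x + g x) \<le> 2 * (f x * f x) + 2 * (g x * g x)"
      using zero_le_square [of "f x - g x"] by (simp add: algebra_simps)
    show "integrable lborel (\<lambda>x. (f x + g x) * (f x + g x))"
      by (intro ip_integrable gauss_decay_add assms)
    show "integrable lborel (\<lambda>x. 2 * (f x * f x) + 2 * (g x * g x))"
      by (intro Bochner_Integration.integrable_add integrable_mult_right ip_integrable assms)
  qed
  then show ?thesis using assms by (simp add: ip_integrable)
qed

text \<open>Makes approximation transitive, so that the rate of a Gaussian can be changed in several
  steps.\<close>

lemma poly_approx_limit:
  assumes f: "gauss_decay f" and t: "t > 0"
    and ex: "\<And>\<epsilon>. \<epsilon> > 0 \<Longrightarrow> \<exists>h. poly_approx t h \<and> ip (\<lambda>x. f x - h x) (\<lambda>x. f x - h x) < \<epsilon>"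
  shows "poly_approx t f"
  unfolding poly_approx_def
proof (intro conjI allI impI f)
  fix \<epsilon> :: real assume "\<epsilon> > 0"
  then have \<epsilon>: "\<epsilon> / 4 > 0" by simp
  obtain h where h: "poly_approx t h" "ip (\<lambda>x. f x - h x) (\<lambda>x. f x - h x) < \<epsilon> / 4"
    using ex [OF \<epsilon>] by blast
  obtain m Q where Q: "poly_lt m Q" "ip (\<lambda>x. h x - Q x * gauss t x) (\<lambda>x. h x - Q x * gauss t x) < \<epsilon> / 4"
    using h(1) \<epsilon> unfolding poly_approx_def by blast
  have hd: "gauss_decay h" using h(1) by (simp add: poly_approx_def)
  have "ip (\<lambda>x. (f x - h x) + (h x - Q x * gauss t x)) (\<lambda>x. (f x - h x) + (h x - Q x * gauss t x))
      \<le> 2 * ip (\<lambda>x. f x - h x) (\<lambda>x. f x - h x)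
        + 2 * ip (\<lambda>x. h x - Q x * gauss t x) (\<lambda>x. h x - Q x * gauss t x)"
    by (intro ip_add_self_le gauss_decay_diff f hd gauss_decay_poly [OF Q(1) t])
  then show "\<exists>m Q. poly_lt m Q \<and> ip (\<lambda>x. f x - Q x * gauss t x) (\<lambda>x. f x - Q x * gauss t x) < \<epsilon>"
    using h(2) Q by (intro exI [of _ m] exI [of _ Q]) simp
qed

lemma poly_approx_add:
  assumes t: "t > 0" and f: "poly_approx t f" and g: "poly_approx t g"
  shows "poly_approx t (\<lambda>x. f x + g x)"
  unfolding poly_approx_def
proof (intro conjI allI impI)
  have fd: "gauss_decay f" and gd: "gauss_decay g" using f g by (simp_all add: poly_approx_def)
  then show "gauss_decay (\<lambda>x. f x + g x)" by (rule gauss_decay_add)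
  fix \<epsilon> :: real assume "\<epsilon> > 0"
  then have \<epsilon>: "\<epsilon> / 4 > 0" by simp
  obtain m P where P: "poly_lt m P" "ip (\<lambda>x. f x - P x * gauss t x) (\<lambda>x. f x - P x * gauss t x) < \<epsilon> / 4"
    using f \<epsilon> unfolding poly_approx_def by blast
  obtain n Q where Q: "poly_lt n Q" "ip (\<lambda>x. g x - Q x * gauss t x) (\<lambda>x. g x - Q x * gauss t x) < \<epsilon> / 4"
    using g \<epsilon> unfolding poly_approx_def by blast
  have "ip (\<lambda>x. (f x - P x * gauss t x) + (g x - Q x * gauss t x))
          (\<lambda>x. (f x - P x * gauss t x) + (g x - Q x * gauss t x))
      \<le> 2 * ip (\<lambda>x. f x - P x * gauss t x) (\<lambda>x. f x - P x * gauss t x)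
        + 2 * ip (\<lambda>x. g x - Q x * gauss t x) (\<lambda>x. g x - Q x * gauss t x)"
    by (intro ip_add_self_le gauss_decay_diff fd gd gauss_decay_poly [OF P(1) t] gauss_decay_poly [OF Q(1) t])
  moreover have "f x - P x * gauss t x + (g x - Q x * gauss t x) = f x + g x - (P x + Q x) * gauss t x" for x
    by (simp add: algebra_simps)
  moreover have "poly_lt (max m n) (\<lambda>x. P x + Q x)"
    by (intro poly_lt.add poly_lt_mono [OF P(1)] poly_lt_mono [OF Q(1)]) auto
  ultimately show "\<exists>m Q. poly_lt m Q \<and>
      ip (\<lambda>x. f x + g x - Q x * gauss t x) (\<lambda>x. f x + g x - Q x * gauss t x) < \<epsilon>"
    using P(2) Q(2) by (intro exI [of _ "max m n"] exI [of _ "\<lambda>x. P x + Q x"]) simp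
qed

lemma abs_exp_partial_sum_le: "\<bar>\<Sum>k<n. (y::real) ^ k / fact k\<bar> \<le> exp \<bar>y\<bar>"
proof -
  have "\<bar>\<Sum>k<n. y ^ k / fact k\<bar> \<le> (\<Sum>k<n. \<bar>y\<bar> ^ k / fact k)"
    by (rule order_trans [OF sum_abs]) (simp add: power_abs)
  also have "\<dots> \<le> (\<Sum>k. \<bar>y\<bar> ^ k / fact k)"
    using summable_exp_generic [of "\<bar>y\<bar>"]
    by (intro sum_le_suminf) (auto simp: divide_inverse mult.commute)
  also have "\<dots> = exp \<bar>y\<bar>" by (simp add: exp_def divide_inverse mult.commute)
  finally show ?thesis .
qed

lemma poly_lt_exp_partial_sum: "\<exists>m. poly_lt m (\<lambda>x::real^'n. \<Sum>k<n. (- (s * (norm x)\<^sup>2)) ^ k / fact k)"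
proof (induction n)
  case 0
  then show ?case by (auto intro: poly_lt.zero)
next
  case (Suc n)
  then obtain m where m: "poly_lt m (\<lambda>x::real^'n. \<Sum>k<n. (- (s * (norm x)\<^sup>2)) ^ k / fact k)" by blast
  obtain l where l: "poly_lt l (\<lambda>x::real^'n. ((norm x)\<^sup>2) ^ n)"
    using poly_lt_power [OF poly_lt_norm2] by blast
  have "poly_lt (max m l) (\<lambda>x::real^'n. (\<Sum>k<n. (- (s * (norm x)\<^sup>2)) ^ k / fact k)
      + ((- s) ^ n / fact n) * ((norm x)\<^sup>2) ^ n)"
    by (intro poly_lt.add poly_lt_cmult poly_lt_mono [OF m] poly_lt_mono [OF l]) auto
  moreover have "((- s) ^ n / fact n) * ((norm x)\<^sup>2) ^ n = (- (s * (norm x)\<^sup>2)) ^ n / fact n" for x :: "real^'n"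
    by (simp only: minus_mult_left power_mult_distrib times_divide_eq_left)
  ultimately show ?case by auto
qed

text \<open>The Taylor polynomials of \<open>exp (- (t - t\<^sub>0) |x|\<^sup>2)\<close> are dominated by \<open>exp ((t - t\<^sub>0) |x|\<^sup>2)\<close>,
  which the weight \<open>exp (- t\<^sub>0 |x|\<^sup>2)\<close> absorbs when \<open>t < 2 t\<^sub>0\<close>.\<close>

lemma poly_approx_gauss_step:
  fixes Q :: "real^'n \<Rightarrow> real"
  assumes Q: "poly_lt m Q" and t0: "t0 > 0" and t: "t0 \<le> t" "t < 2 * t0"
  shows "poly_approx t0 (\<lambda>x. Q x * gauss t x)"
  unfolding poly_approx_def
proof (intro conjI allI impI)
  show "gauss_decay (\<lambda>x. Q x * gauss t x)" using t0 t by (intro gauss_decay_poly [OF Q]) auto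
  fix \<epsilon> :: real assume \<epsilon>: "\<epsilon> > 0"
  define s where "s = t - t0"
  define S where "S n x = (\<Sum>k<n. (- (s * (norm x)\<^sup>2)) ^ k / fact k)" for n and x :: "real^'n"
  define q where "q n x = Q x * gauss t x - (S n x * Q x) * gauss t0 x" for n x
  have s: "0 \<le> s" "s < t0" using t by (auto simp: s_def)
  have [measurable]: "Q \<in> borel_measurable borel"
    by (intro borel_measurable_continuous_onI poly_lt_continuous [OF Q])
  have [measurable]: "S n \<in> borel_measurable borel" for n
    unfolding S_def by (intro borel_measurable_continuous_onI continuous_intros) auto
  have qeq: "q n x = Q x * gauss t0 x * (gauss s x - S n x)" for n x
  proof -
    have "gauss t x = gauss t0 x * gauss s x" by (simp add: gauss_mult s_def)
    then show ?thesis by (simp add: q_def algebra_simps)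
  qed
  have "(\<lambda>n. \<integral>x. q n x * q n x \<partial>lborel) \<longlonglongrightarrow> (\<integral>x. 0 \<partial>(lborel :: (real^'n) measure))"
  proof (rule integral_dominated_convergence)
    let ?w = "\<lambda>x. 2 * (Q x * gauss (t0 - s) x)"
    show "integrable lborel (\<lambda>x. ?w x * ?w x)"
      using s by (intro ip_integrable gauss_decay_cmult gauss_decay_poly [OF Q]) auto
    show "AE x in lborel. norm (q n x * q n x) \<le> ?w x * ?w x" for n
    proof (rule AE_I2)
      fix x :: "real^'n"
      have "\<bar>S n x\<bar> \<le> gauss (- s) x"
        using abs_exp_partial_sum_le [of "- (s * (norm x)\<^sup>2)" n] s by (simp add: S_def gauss_def)
      moreover have "gauss s x \<le> gauss (- s) x" using s by (intro gauss_mono) simp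
      ultimately have "\<bar>gauss s x - S n x\<bar> \<le> 2 * gauss (- s) x"
        using gauss_pos(1) [of s x] by linarith
      then have "\<bar>q n x\<bar> \<le> \<bar>Q x\<bar> * gauss t0 x * (2 * gauss (- s) x)"
        unfolding qeq abs_mult by (intro mult_mono) auto
      also have "\<dots> = 2 * \<bar>Q x\<bar> * (gauss t0 x * gauss (- s) x)" by simp
      also have "\<dots> = \<bar>?w x\<bar>" by (simp add: gauss_mult abs_mult)
      finally have "\<bar>q n x\<bar> * \<bar>q n x\<bar> \<le> \<bar>?w x\<bar> * \<bar>?w x\<bar>" by (intro mult_mono) auto
      then show "norm (q n x * q n x) \<le> ?w x * ?w x" by (simp add: abs_mult)
    qed
    show "AE x in lborel. (\<lambda>n. q n x * q n x) \<longlonglongrightarrow> 0"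
    proof (rule AE_I2)
      fix x :: "real^'n"
      have "(\<lambda>n. S n x) \<longlonglongrightarrow> gauss s x"
        using exp_converges [of "- (s * (norm x)\<^sup>2)"]
        by (simp add: sums_def S_def gauss_def divide_inverse mult.commute)
      then have "(\<lambda>n. Q x * gauss t0 x * (gauss s x - S n x)) \<longlonglongrightarrow> Q x * gauss t0 x * (gauss s x - gauss s x)"
        by (intro tendsto_intros)
      then have "(\<lambda>n. q n x) \<longlonglongrightarrow> 0" by (simp add: qeq)
      from tendsto_mult [OF this this] show "(\<lambda>n. q n x * q n x) \<longlonglongrightarrow> 0" by simp
    qed
  qed (simp_all add: q_def)
  then have "eventually (\<lambda>n. (\<integral>x. q n x * q n x \<partial>lborel) < \<epsilon>) sequentially"
    using \<epsilon> by (intro order_tendstoD) auto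
  then obtain n where n: "(\<integral>x. q n x * q n x \<partial>lborel) < \<epsilon>"
    by (auto simp: eventually_sequentially)
  obtain k where "poly_lt k (S n)"
    using poly_lt_exp_partial_sum [of s n] unfolding S_def by blast
  then have "poly_lt (k + m) (\<lambda>x. S n x * Q x)" by (rule poly_lt_mult [OF _ Q])
  with n show "\<exists>k R. poly_lt k R \<and> ip (\<lambda>x. Q x * gauss t x - R x * gauss t0 x)
      (\<lambda>x. Q x * gauss t x - R x * gauss t0 x) < \<epsilon>"
    unfolding q_def by blast
qed

text \<open>The restriction \<open>t < 2 * t0\<close> of a single step is removed by iteration: each
  step shrinks the rate by the factor \<open>2 / 3\<close>, and \<open>n\<close> counts the
  steps.\<close>

lemma poly_approx_gauss:
  fixes Q :: "real^'n \<Rightarrow> real"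
  assumes Q: "poly_lt m Q" and t0: "t0 > 0" and t: "t0 \<le> t"
  shows "poly_approx t0 (\<lambda>x. Q x * gauss t x)"
proof -
  have "poly_approx t0 (\<lambda>x. Q x * gauss t x)"
    if "poly_lt m Q" "t0 \<le> t" "t < t0 * (3 / 2) ^ n" for n m t and Q :: "real^'n \<Rightarrow> real"
    using that
  proof (induction n arbitrary: m t Q)
    case (Suc n)
    show ?case
    proof (cases "t < 2 * t0")
      case True
      then show ?thesis using Suc.prems t0 by (intro poly_approx_gauss_step) auto
    next
      case False
      \<comment> \<open>\<open>2 / 3\<close> exceeds \<open>1 / 2\<close>, so
        \<open>t < 2 * t'\<close> permits one step from \<open>t\<close> to \<open>t'\<close>; and
        \<open>t \<ge> 2 * t0\<close> keeps \<open>t'\<close> above \<open>t0\<close>.\<close>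
      define t' where "t' = t * (2 / 3)"
      have t': "t0 \<le> t'" "t' < t0 * (3 / 2) ^ n" "t' \<le> t" "t < 2 * t'"
        using False Suc.prems t0 by (auto simp: t'_def)
      have approx: "poly_approx t' (\<lambda>x. Q x * gauss t x)"
        using t' t0 by (intro poly_approx_gauss_step [OF Suc.prems(1)]) auto
      show ?thesis
      proof (rule poly_approx_limit [OF _ t0])
        show "gauss_decay (\<lambda>x. Q x * gauss t x)" using approx by (simp add: poly_approx_def)
        fix \<epsilon> :: real assume "\<epsilon> > 0"
        then obtain k R where "poly_lt k R"
          "ip (\<lambda>x. Q x * gauss t x - R x * gauss t' x) (\<lambda>x. Q x * gauss t x - R x * gauss t' x) < \<epsilon>"
          using approx unfolding poly_approx_def by blast
        with Suc.IH [OF _ t'(1,2)] show "\<exists>h. poly_approx t0 h \<and>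
            ip (\<lambda>x. Q x * gauss t x - h x) (\<lambda>x. Q x * gauss t x - h x) < \<epsilon>" by blast
      qed
    qed
  qed simp
  moreover obtain n where "t / t0 < (3 / 2) ^ n" using real_arch_pow [of "3 / 2" "t / t0"] by auto
  then have "t < t0 * (3 / 2) ^ n" using t0 by (simp add: field_simps)
  ultimately show ?thesis using Q t by blast
qed

text \<open>The algebra into which polynomials on the embedded space pull back. The rate
  \<open>k = 0\<close> admits the constants; decay is restored later by a further factor
  \<open>gauss t\<close>.\<close>

inductive poly_gauss :: "(real^'n \<Rightarrow> real) \<Rightarrow> bool" where
  base: "poly_lt m Q \<Longrightarrow> 0 \<le> k \<Longrightarrow> poly_gauss (\<lambda>x. Q x * gauss k x)"
| add: "poly_gauss f \<Longrightarrow> poly_gauss g \<Longrightarrow> poly_gauss (\<lambda>x. f x + g x)"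

lemma poly_gauss_mult:
  assumes "poly_gauss f" "poly_gauss g"
  shows "poly_gauss (\<lambda>x. f x * g x)"
  using assms
proof (induction rule: poly_gauss.induct)
  case (base m Q k)
  from base.prems base.hyps show ?case
  proof (induction rule: poly_gauss.induct)
    case (base n R l)
    then have "poly_gauss (\<lambda>x. (Q x * R x) * gauss (k + l) x)"
      by (intro poly_gauss.base [OF poly_lt_mult]) auto
    then show ?case by (simp add: gauss_mult [symmetric] mult_ac)
  qed (auto simp: distrib_left intro: poly_gauss.add)
qed (auto simp: distrib_right intro: poly_gauss.add)

text \<open>The map \<open>x \<mapsto> (exp (-|x|\<^sup>2) x, exp (-|x|\<^sup>2))\<close> embeds the space into a compact set, and the
  polynomials on its target pull back to polynomials times Gaussians.\<close>

lemma poly_gauss_embed: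
  fixes p :: "(real^'n) \<times> real \<Rightarrow> real"
  assumes "real_polynomial_function p"
  shows "poly_gauss (\<lambda>x. p (gauss 1 x *\<^sub>R x, gauss 1 x))"
  using assms
proof (induction rule: real_polynomial_function.induct)
  case (linear f)
  then interpret bounded_linear f .
  have "f (gauss 1 x *\<^sub>R x, gauss 1 x) = ((\<Sum>i\<in>UNIV. x $ i * f (axis i 1, 0)) + f (0, 1)) * gauss 1 x" for x
  proof -
    have "(gauss 1 x *\<^sub>R x, gauss 1 x) = gauss 1 x *\<^sub>R ((\<Sum>i\<in>UNIV. x $ i *\<^sub>R (axis i 1, 0)) + (0, 1))"
      by (simp add: sum_prod scaleR_prod_def basis_expansion [of x, unfolded scalar_mult_eq_scaleR])
    then show ?thesis by (simp only: scaleR add sum) (simp add: mult.commute)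
  qed
  moreover have "poly_lt 2 (\<lambda>x. (\<Sum>i\<in>UNIV. x $ i * f (axis i 1, 0)) + f (0, 1))"
    unfolding numeral_2_eq_2 by (intro poly_lt.add poly_lt_sum poly_lt.coord poly_lt.const)
  ultimately show ?case using poly_gauss.base [of 2 _ 1] by simp
next
  case (const c)
  then show ?case using poly_gauss.base [OF poly_lt.const [of 0 c], of 0] by (simp add: gauss_def)
qed (auto intro: poly_gauss.add poly_gauss_mult)

text \<open>The extra factor raises every rate to \<open>k + t \<ge> t\<close>, where
  \<open>poly_approx_gauss\<close> applies.\<close>

lemma poly_approx_poly_gauss:
  assumes "poly_gauss h" "t > 0"
  shows "poly_approx t (\<lambda>x. h x * gauss t x)"
  using assms(1)
proof (induction rule: poly_gauss.induct)
  case (base m Q k)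
  then have "poly_approx t (\<lambda>x. Q x * gauss (k + t) x)"
    using assms(2) by (intro poly_approx_gauss) auto
  then show ?case by (simp add: gauss_mult [symmetric] mult.assoc)
qed (auto simp: distrib_right intro: poly_approx_add assms(2))

lemma gauss_decay_compact_support:
  fixes u :: "'a::euclidean_space \<Rightarrow> real"
  assumes u: "continuous_on UNIV u" and supp: "\<And>x. norm x > r \<Longrightarrow> u x = 0"
  shows "gauss_decay u"
proof -
  have "compact ((\<lambda>x. u x / gauss 1 x) ` cball 0 r)"
    by (intro compact_continuous_image continuous_intros continuous_on_subset [OF u]) auto
  then have "bounded ((\<lambda>x. u x / gauss 1 x) ` cball 0 r)" by (rule compact_imp_bounded)
  then obtain C where C0: "\<And>y. y \<in> (\<lambda>x. u x / gauss 1 x) ` cball 0 r \<Longrightarrow> norm y \<le> C"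
    unfolding bounded_iff by metis
  have C: "\<bar>u x / gauss 1 x\<bar> \<le> C" if "norm x \<le> r" for x
    by (rule C0 [unfolded real_norm_def]) (use that in auto)
  show ?thesis
  \<comment> \<open>For negative \<open>r\<close> the ball is empty and \<open>C\<close> may be
    negative, hence the maximum with 0.\<close>
  proof (rule gauss_decayI [of _ 1 "max C 0"])
    fix x
    show "\<bar>u x\<bar> \<le> max C 0 * gauss 1 x"
    proof (cases "norm x \<le> r")
      case True
      then have "\<bar>u x\<bar> \<le> C * gauss 1 x" using C [OF True] by (simp add: abs_divide field_simps)
      also have "\<dots> \<le> max C 0 * gauss 1 x" by (intro mult_right_mono) auto
      finally show ?thesis .
    qed (use supp in auto)
  qed (use borel_measurable_continuous_onI [OF u] in auto)
qed

text \<open>On the image of the embedding, \<open>(y, s)\<close> comes from \<open>y / s\<close>; below \<open>s = \<delta>\<close>, which is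
  half the smallest value of \<open>s\<close> over the support of \<open>g\<close>, a cutoff replaces this singular
  formula.\<close>

lemma poly_gauss_dense:
  fixes g :: "real^'n \<Rightarrow> real"
  assumes g: "continuous_on UNIV g" and supp: "\<And>x. norm x > r \<Longrightarrow> g x = 0" and r: "r \<ge> 0"
    and \<eta>: "\<eta> > 0"
  obtains h where "poly_gauss h" "\<And>x. \<bar>g x - h x\<bar> < \<eta>"
proof -
  define \<delta> where "\<delta> = exp (- r\<^sup>2) / 2"
  have \<delta>: "\<delta> > 0" by (simp add: \<delta>_def)
  define G where "G z = g (inverse (max (snd z) \<delta>) *\<^sub>R fst z) * min 1 (max 0 ((snd z - \<delta>) / \<delta>))"
    for z :: "(real^'n) \<times> real"
  have cont: "continuous_on (cball 0 2) G"
    unfolding G_def using \<delta>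
    by (intro continuous_intros continuous_on_compose2 [OF g]) (auto simp: max_def)
  obtain p where p: "real_polynomial_function p" "\<And>z. z \<in> cball 0 2 \<Longrightarrow> \<bar>G z - p z\<bar> < \<eta>"
    using Stone_Weierstrass_real_polynomial_function [OF compact_cball cont \<eta>] by blast
  have "\<bar>g x - p (gauss 1 x *\<^sub>R x, gauss 1 x)\<bar> < \<eta>" for x
  proof -
    \<comment> \<open>The embedded point has norm at most
      \<open>norm x * gauss 1 x + gauss 1 x \<le> 2\<close>, whence the radius of the ball.\<close>
    have "norm x \<le> 1 + (norm x)\<^sup>2"
      using zero_le_power2 [of "norm x - 1/2"] by (simp add: power2_eq_square algebra_simps)
    also have "\<dots> \<le> exp ((norm x)\<^sup>2)" by (rule exp_ge_add_one_self)
    finally have "norm x * gauss 1 x \<le> 1" by (simp add: gauss_def exp_minus field_simps)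
    moreover have "norm (gauss 1 x *\<^sub>R x, gauss 1 x) \<le> norm (gauss 1 x *\<^sub>R x) + norm (gauss 1 x)"
      by (rule norm_Pair_le)
    ultimately have "(gauss 1 x *\<^sub>R x, gauss 1 x) \<in> cball 0 2"
      using gauss_le_1 [of 1 x] by (simp add: mult.commute)
    from p(2) [OF this] have "\<bar>G (gauss 1 x *\<^sub>R x, gauss 1 x) - p (gauss 1 x *\<^sub>R x, gauss 1 x)\<bar> < \<eta>" .
    moreover have "G (gauss 1 x *\<^sub>R x, gauss 1 x) = g x"
    proof (cases "norm x \<le> r")
      case True
      then have "(norm x)\<^sup>2 \<le> r\<^sup>2" by (intro power_mono) auto
      \<comment> \<open>Both cutoffs are inactive here: the maximum is \<open>gauss 1 x\<close> and
        the second factor of \<open>G\<close> is 1.\<close>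
      then have "gauss 1 x \<ge> 2 * \<delta>" by (simp add: gauss_def \<delta>_def)
      then show ?thesis using \<delta> by (simp add: G_def max_def field_simps)
    next
      case False
      \<comment> \<open>Either \<open>gauss 1 x \<le> \<delta>\<close> and the second factor
        vanishes, or the first factor is \<open>g x = 0\<close>.\<close>
      then show ?thesis using \<delta> supp [of x] by (cases "gauss 1 x \<le> \<delta>") (auto simp: G_def max_def field_simps)
    qed
    ultimately show ?thesis by simp
  qed
  then show ?thesis using that poly_gauss_embed [OF p(1)] by blast
qed

text \<open>Uniform approximation of \<open>u\<close> divided by the Gaussian turns into mean-square
  approximation of \<open>u\<close> after multiplying back by the square-integrable
  Gaussian.\<close>

lemma poly_approx_compact_support:
  fixes u :: "real^'n \<Rightarrow> real"
  assumes u: "continuous_on UNIV u" and supp: "\<And>x. norm x > r \<Longrightarrow> u x = 0" and r: "r \<ge> 0"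
    and t: "t > 0"
  shows "poly_approx t u"
proof (rule poly_approx_limit [OF gauss_decay_compact_support [OF u supp] t])
  fix \<epsilon> :: real assume \<epsilon>: "\<epsilon> > 0"
  define K where "K = ip (gauss t) (gauss t :: real^'n \<Rightarrow> real)"
  have K: "K \<ge> 0" by (simp add: K_def)
  \<comment> \<open>The squared error will be at most \<open>\<eta>\<^sup>2 * K\<close>; with
    \<open>K + 1\<close> in the denominator this is strictly below
    \<open>\<epsilon>\<close>.\<close>
  define \<eta> where "\<eta> = sqrt (\<epsilon> / (K + 1))"
  have "\<eta> * \<eta> = \<epsilon> / (K + 1)" using K \<epsilon> by (simp add: \<eta>_def)
  moreover have "\<epsilon> / (K + 1) * K < \<epsilon>" using K \<epsilon> by (simp add: field_simps)
  ultimately have \<eta>: "\<eta> > 0" "\<eta> * \<eta> * K < \<epsilon>" using K \<epsilon> by (simp_all add: \<eta>_def)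
  have "continuous_on UNIV (\<lambda>x. u x * gauss (- t) x)" by (intro continuous_intros u)
  then obtain h where h: "poly_gauss h" "\<And>x. \<bar>u x * gauss (- t) x - h x\<bar> < \<eta>"
    using poly_gauss_dense [of "\<lambda>x. u x * gauss (- t) x" r \<eta>] supp r \<eta> by auto
  have app: "poly_approx t (\<lambda>x. h x * gauss t x)" by (rule poly_approx_poly_gauss [OF h(1) t])
  have "ip (\<lambda>x. u x - h x * gauss t x) (\<lambda>x. u x - h x * gauss t x)
      \<le> (\<integral>x. (\<eta> * gauss t x) * (\<eta> * gauss t (x :: real^'n)) \<partial>lborel)"
  proof (rule integral_mono)
    show "integrable lborel (\<lambda>x. (u x - h x * gauss t x) * (u x - h x * gauss t x))"
      using app gauss_decay_compact_support [OF u supp]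
      by (intro ip_integrable gauss_decay_diff) (auto simp: poly_approx_def)
    show "integrable lborel (\<lambda>x::real^'n. (\<eta> * gauss t x) * (\<eta> * gauss t x))"
      by (intro ip_integrable gauss_decay_cmult gauss_decay_gauss t)
    fix x :: "real^'n"
    have "gauss (- t) x * gauss t x = 1" by (simp add: gauss_mult) (simp add: gauss_def)
    then have "u x = u x * (gauss (- t) x * gauss t x)" by simp
    then have "u x - h x * gauss t x = (u x * gauss (- t) x - h x) * gauss t x"
      by (simp add: algebra_simps)
    then have *: "\<bar>u x - h x * gauss t x\<bar> \<le> \<eta> * gauss t x"
      using h(2) [of x] by (simp add: abs_mult less_imp_le)
    from mult_mono [OF * *] show "(u x - h x * gauss t x) * (u x - h x * gauss t x)
        \<le> (\<eta> * gauss t x) * (\<eta> * gauss t x)" using \<eta> by simp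
  qed
  also have "\<dots> = \<eta> * \<eta> * K" by (simp add: K_def mult.assoc mult.left_commute)
  finally show "\<exists>h. poly_approx t h \<and> ip (\<lambda>x. u x - h x) (\<lambda>x. u x - h x) < \<epsilon>"
    using app \<eta> by (intro exI [of _ "\<lambda>x. h x * gauss t x"]) simp
qed

section \<open>Test functions and the deficit\<close>

text \<open>After expanding the squares only the cross terms need an argument: by parts, twice the
  inner product of \<open>f' i\<close> and \<open>x $ i * f x\<close> is minus the squared norm of
  \<open>f\<close>. Summing over \<open>i\<close> produces the dimension.\<close>

lemma annihilation_norm:
  fixes f :: "real^'n \<Rightarrow> real"
  assumes hp: "\<And>i. has_partial i f (f' i)" and f: "gauss_decay f" and f': "\<And>i. gauss_decay (f' i)"
  shows "(\<Sum>i\<in>UNIV. ip (\<lambda>x. f' i x + b * (x $ i * f x)) (\<lambda>x. f' i x + b * (x $ i * f x)))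
    = (\<Sum>i\<in>UNIV. \<integral>x. (f' i x)\<^sup>2 \<partial>lborel) + b\<^sup>2 * (\<integral>x. (norm x)\<^sup>2 * (f x)\<^sup>2 \<partial>lborel)
      - b * real CARD('n) * (\<integral>x. (f x)\<^sup>2 \<partial>lborel)"
proof -
  have xf: "gauss_decay (\<lambda>x. x $ i * f x)" for i by (intro gauss_decay_coord f)
  have "ip (\<lambda>x. f' i x + b * (x $ i * f x)) (\<lambda>x. f' i x + b * (x $ i * f x))
      = (\<integral>x. (f' i x)\<^sup>2 \<partial>lborel) - b * (\<integral>x. (f x)\<^sup>2 \<partial>lborel)
        + b\<^sup>2 * (\<integral>x. (x $ i * f x)\<^sup>2 \<partial>lborel)" for i
  proof -
    have 1: "has_partial i (\<lambda>x. x $ i * f x) (\<lambda>x. f x + x $ i * f' i x)"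
      using has_partial_mult [OF has_partial_coord [of i i] hp [of i]] by simp
    have 2: "gauss_decay (\<lambda>x. f x + x $ i * f' i x)"
      by (intro gauss_decay_add gauss_decay_coord f f')
    have "ip (f' i) (\<lambda>x. x $ i * f x) = - (\<integral>x. f x * (f x + x $ i * f' i x) \<partial>lborel)"
      by (rule integral_by_parts_partial [OF hp 1 f f' xf 2])
    also have "(\<integral>x. f x * (f x + x $ i * f' i x) \<partial>lborel)
        = (\<integral>x. f x * f x + f' i x * (x $ i * f x) \<partial>lborel)"
      by (simp add: algebra_simps)
    also have "\<dots> = (\<integral>x. (f x)\<^sup>2 \<partial>lborel) + ip (f' i) (\<lambda>x. x $ i * f x)"
      using ip_integrable [OF f f] ip_integrable [OF f' xf] by (simp add: power2_eq_square)
    finally have cross: "2 * ip (f' i) (\<lambda>x. x $ i * f x) = - (\<integral>x. (f x)\<^sup>2 \<partial>lborel)" by simp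
    have "ip (\<lambda>x. f' i x + b * (x $ i * f x)) (\<lambda>x. f' i x + b * (x $ i * f x))
      = (\<integral>x. f' i x * f' i x + b * (2 * (f' i x * (x $ i * f x)))
          + b\<^sup>2 * ((x $ i * f x) * (x $ i * f x)) \<partial>lborel)"
      by (intro Bochner_Integration.integral_cong refl) (simp add: power2_eq_square algebra_simps)
    also have "\<dots> = ip (f' i) (f' i) + b * (2 * ip (f' i) (\<lambda>x. x $ i * f x))
        + b\<^sup>2 * ip (\<lambda>x. x $ i * f x) (\<lambda>x. x $ i * f x)"
      using ip_integrable [OF f' f', of i i] ip_integrable [OF f' xf, of i i] ip_integrable [OF xf xf, of i i]
      by simp
    finally show ?thesis unfolding cross by (simp add: power2_eq_square)
  qed
  moreover have "(\<Sum>i\<in>UNIV. \<integral>x. (x $ i * f x)\<^sup>2 \<partial>lborel) = (\<integral>x. (norm x)\<^sup>2 * (f x)\<^sup>2 \<partial>lborel)"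
  proof -
    have "(\<Sum>i\<in>UNIV. \<integral>x. (x $ i * f x)\<^sup>2 \<partial>lborel) = (\<integral>x. (\<Sum>i\<in>UNIV. (x $ i * f x)\<^sup>2) \<partial>lborel)"
      by (rule Bochner_Integration.integral_sum [symmetric])
         (intro gauss_decay_integrable gauss_decay_power2 xf)
    then show ?thesis by (simp add: norm_sum_coord power_mult_distrib sum_distrib_right)
  qed
  ultimately show ?thesis
    by (simp add: sum.distrib sum_subtractf sum_distrib_left [symmetric])
qed

lemma test_function_C_k: "u \<in> test_functions \<Longrightarrow> C_k k u"
  by (simp add: test_functions_def)

lemma test_function_differentiable: "u \<in> test_functions \<Longrightarrow> u differentiable (at x)"
  using test_function_C_k [of u "Suc 0"] by (simp add: differentiable_on_def)

lemma test_function_continuous: "u \<in> test_functions \<Longrightarrow> continuous_on UNIV u"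
  using test_function_C_k [of u 0] by simp

lemma test_function_partial_continuous:
  "u \<in> test_functions \<Longrightarrow> continuous_on UNIV (partial_deriv i u)"
  using test_function_C_k [of u "Suc 0"] by simp

lemma test_function_support:
  assumes "u \<in> test_functions"
  obtains r where "r \<ge> 0" "\<And>x. norm x > r \<Longrightarrow> u x = 0" "\<And>i x. norm x > r \<Longrightarrow> partial_deriv i u x = 0"
proof -
  have "compact (closure {x. u x \<noteq> 0})" using assms by (simp add: test_functions_def)
  then have "bounded (closure {x. u x \<noteq> 0})" by (rule compact_imp_bounded)
  then have "bounded {x. u x \<noteq> 0}" by (rule bounded_subset) (rule closure_subset)
  then obtain r where r: "r > 0" "\<And>x. u x \<noteq> 0 \<Longrightarrow> norm x \<le> r"
    unfolding bounded_pos by blast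
  have 0: "u x = 0" if "norm x > r" for x using r(2) [of x] that by (meson not_le)
  have "partial_deriv i u x = 0" if x: "norm x > r" for i x
  proof -
    have "open {y :: real^'a. norm y > r}" by (intro open_Collect_less continuous_intros)
    from has_derivative_transform_within_open [OF has_derivative_const this, of x 0 u]
    have "(u has_derivative (\<lambda>_. 0)) (at x)" using x 0 by simp
    then have "frechet_derivative u (at x) = (\<lambda>_. 0)" by (rule frechet_derivative_at [symmetric])
    then show ?thesis by (simp add: partial_deriv_def)
  qed
  with 0 r show ?thesis using that [of r] by simp
qed

lemma has_partial_bounded_linear:
  assumes u: "u differentiable (at (x :: real^'n))" and L: "bounded_linear L"
  shows "((\<lambda>t. L (u (x + t *\<^sub>R axis i 1))) has_real_derivative L (partial_deriv i u x)) (at 0)"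
proof -
  interpret L: bounded_linear L by (rule L)
  let ?D = "frechet_derivative u (at x)"
  have D: "(u has_derivative ?D) (at x)" using u frechet_derivative_works by blast
  interpret D: bounded_linear ?D using D by (rule has_derivative_bounded_linear)
  have "((\<lambda>t. x + t *\<^sub>R axis i 1) has_derivative (\<lambda>t. t *\<^sub>R axis i 1)) (at (0::real))"
    by (auto intro!: derivative_eq_intros)
  from has_derivative_compose [OF this, of u ?D] D
  have "((\<lambda>t. u (x + t *\<^sub>R axis i 1)) has_derivative (\<lambda>t. ?D (t *\<^sub>R axis i 1))) (at 0)" by simp
  from L.has_derivative [OF this]
  have "((\<lambda>t. L (u (x + t *\<^sub>R axis i 1))) has_derivative (\<lambda>t. L (partial_deriv i u x) * t)) (at 0)"
    by (simp add: partial_deriv_def D.scaleR L.scaleR mult.commute)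
  then show ?thesis by (simp add: has_field_derivative_def)
qed

text \<open>The spectral argument is for real functions; \<open>L\<close> will be \<open>Re\<close>
  or \<open>Im\<close>, so one proof serves both parts of \<open>u\<close>.\<close>

lemma spectral_estimate_component:
  fixes u :: "real^'n \<Rightarrow> complex"
  assumes u: "u \<in> test_functions" and L: "bounded_linear L" and b: "b > 0" and \<eta>: "\<eta> > 0"
  shows "gauss_decay (\<lambda>x. L (u x))" "\<And>i. gauss_decay (\<lambda>x. L (partial_deriv i u x))"
    "\<exists>W. (\<forall>j<J. poly_lt (Suc j) (W j)) \<and>
      2 * b * (\<Sum>j<J. \<integral>x. (L (u x) - W j x * gauss (b / 2) x)\<^sup>2 \<partial>lborel)
      \<le> (\<Sum>i\<in>UNIV. \<integral>x. (L (partial_deriv i u x))\<^sup>2 \<partial>lborel)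
        + b\<^sup>2 * (\<integral>x. (norm x)\<^sup>2 * (L (u x))\<^sup>2 \<partial>lborel)
        - b * real CARD('n) * (\<integral>x. (L (u x))\<^sup>2 \<partial>lborel) + \<eta>"
proof -
  interpret L: bounded_linear L by (rule L)
  obtain r where r: "r \<ge> 0" "\<And>x. norm x > r \<Longrightarrow> u x = 0" "\<And>i x. norm x > r \<Longrightarrow> partial_deriv i u x = 0"
    using test_function_support [OF u] by blast
  have Lu: "continuous_on UNIV (\<lambda>x. L (u x))"
    and Lu': "continuous_on UNIV (\<lambda>x. L (partial_deriv i u x))" for i
    using test_function_continuous [OF u] test_function_partial_continuous [OF u]
    by (auto intro: L.continuous_on)
  show f: "gauss_decay (\<lambda>x. L (u x))"
    by (rule gauss_decay_compact_support [OF Lu, of r]) (simp add: r L.zero)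
  show f': "gauss_decay (\<lambda>x. L (partial_deriv i u x))" for i
    by (rule gauss_decay_compact_support [OF Lu', of r]) (simp add: r L.zero)
  have hp: "has_partial i (\<lambda>x. L (u x)) (\<lambda>x. L (partial_deriv i u x))" for i
    unfolding has_partial_def
    by (intro allI has_partial_bounded_linear [OF test_function_differentiable [OF u] L])
  have "poly_approx (b / 2) (\<lambda>x. L (u x))"
    using b by (intro poly_approx_compact_support [OF Lu _ r(1)]) (auto simp: r L.zero)
  from spectral_estimate [OF hp f' b this \<eta>, of J]
  show "\<exists>W. (\<forall>j<J. poly_lt (Suc j) (W j)) \<and>
      2 * b * (\<Sum>j<J. \<integral>x. (L (u x) - W j x * gauss (b / 2) x)\<^sup>2 \<partial>lborel)
      \<le> (\<Sum>i\<in>UNIV. \<integral>x. (L (partial_deriv i u x))\<^sup>2 \<partial>lborel)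
        + b\<^sup>2 * (\<integral>x. (norm x)\<^sup>2 * (L (u x))\<^sup>2 \<partial>lborel)
        - b * real CARD('n) * (\<integral>x. (L (u x))\<^sup>2 \<partial>lborel) + \<eta>"
    unfolding annihilation_norm [OF hp f f'] by (simp add: power2_eq_square)
qed

text \<open>Complex coefficients let the real and imaginary polynomials be chosen independently; the
  bound \<open>Suc j\<close> is strict and means degree at most \<open>j\<close>.\<close>

lemma poly_lt_imp_gauss_polys:
  assumes P: "poly_lt (Suc j) P" and Q: "poly_lt (Suc j) Q" and \<beta>: "\<beta> > 0"
  shows "(\<lambda>x. Complex (P x * gauss \<beta> x) (Q x * gauss \<beta> x)) \<in> gauss_polys j"
proof -
  obtain c where c: "P = (\<lambda>x. \<Sum>\<alpha>\<in>multi_indices j. c \<alpha> * monomial \<alpha> x)"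
    using poly_lt_expand [OF P] unfolding indices_lt_Suc by blast
  obtain d where d: "Q = (\<lambda>x. \<Sum>\<alpha>\<in>multi_indices j. d \<alpha> * monomial \<alpha> x)"
    using poly_lt_expand [OF Q] unfolding indices_lt_Suc by blast
  let ?R = "\<lambda>x. \<Sum>\<alpha>\<in>multi_indices j. Complex (c \<alpha>) (d \<alpha>) * of_real (monomial \<alpha> x)"
  have "?R \<in> polys_le j" unfolding polys_le_def
    by (intro CollectI exI [of _ "\<lambda>\<alpha>. Complex (c \<alpha>) (d \<alpha>)"] refl)
  moreover have "Complex (P x * gauss \<beta> x) (Q x * gauss \<beta> x) = ?R x * of_real (exp (- \<beta> * (norm x)\<^sup>2))" for x
    by (simp add: complex_eq_iff c d gauss_def)
  ultimately show ?thesis using \<beta> unfolding gauss_polys_def by blast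
qed

lemma integral_cmod_power2:
  assumes "gauss_decay (\<lambda>x. Re (f x))" "gauss_decay (\<lambda>x. Im (f x))"
  shows "(\<integral>x. (norm (f x))\<^sup>2 \<partial>lborel) = (\<integral>x. (Re (f x))\<^sup>2 \<partial>lborel) + (\<integral>x. (Im (f x))\<^sup>2 \<partial>lborel)"
  using assms by (simp add: cmod_power2 gauss_decay_integrable gauss_decay_power2)

text \<open>The estimates for \<open>Re\<close> and \<open>Im\<close> add up, and their witnesses
  combine into one element of \<open>gauss_polys j\<close> of rate \<open>b / 2\<close>, which
  bounds the infimum over all rates from above.\<close>

lemma deficit_ge:
  fixes u :: "real^'n \<Rightarrow> complex"
  assumes u: "u \<in> test_functions" and b: "b > 0"
  shows "2 * b * (\<Sum>j<J. INF w\<in>gauss_polys j. \<integral>x. (norm (u x - w x))\<^sup>2 \<partial>lborel)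
    \<le> (\<integral>x. (norm (gradient u x))\<^sup>2 \<partial>lborel) + b\<^sup>2 * (\<integral>x. (norm x)\<^sup>2 * (norm (u x))\<^sup>2 \<partial>lborel)
      - b * real CARD('n) * (\<integral>x. (norm (u x))\<^sup>2 \<partial>lborel)"
proof (rule field_le_epsilon)
  fix \<epsilon> :: real assume "\<epsilon> > 0"
  then have \<eta>: "\<epsilon> / 2 > 0" by simp
  note R = spectral_estimate_component [OF u bounded_linear_Re b \<eta>]
  note I = spectral_estimate_component [OF u bounded_linear_Im b \<eta>]
  let ?g = "gauss (b / 2) :: real^'n \<Rightarrow> real"
  obtain V where V: "\<forall>j<J. poly_lt (Suc j) (V j)"
    "2 * b * (\<Sum>j<J. \<integral>x. (Re (u x) - V j x * ?g x)\<^sup>2 \<partial>lborel)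
      \<le> (\<Sum>i\<in>UNIV. \<integral>x. (Re (partial_deriv i u x))\<^sup>2 \<partial>lborel)
        + b\<^sup>2 * (\<integral>x. (norm x)\<^sup>2 * (Re (u x))\<^sup>2 \<partial>lborel)
        - b * real CARD('n) * (\<integral>x. (Re (u x))\<^sup>2 \<partial>lborel) + \<epsilon> / 2"
    using R(3) [of J] by blast
  obtain W where W: "\<forall>j<J. poly_lt (Suc j) (W j)"
    "2 * b * (\<Sum>j<J. \<integral>x. (Im (u x) - W j x * ?g x)\<^sup>2 \<partial>lborel)
      \<le> (\<Sum>i\<in>UNIV. \<integral>x. (Im (partial_deriv i u x))\<^sup>2 \<partial>lborel)
        + b\<^sup>2 * (\<integral>x. (norm x)\<^sup>2 * (Im (u x))\<^sup>2 \<partial>lborel)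
        - b * real CARD('n) * (\<integral>x. (Im (u x))\<^sup>2 \<partial>lborel) + \<epsilon> / 2"
    using I(3) [of J] by blast
  have grad: "(\<integral>x. (norm (gradient u x))\<^sup>2 \<partial>lborel)
      = (\<Sum>i\<in>UNIV. \<integral>x. (Re (partial_deriv i u x))\<^sup>2 \<partial>lborel)
        + (\<Sum>i\<in>UNIV. \<integral>x. (Im (partial_deriv i u x))\<^sup>2 \<partial>lborel)"
  proof -
    have "(norm (gradient u x))\<^sup>2
        = (\<Sum>i\<in>UNIV. (Re (partial_deriv i u x))\<^sup>2 + (Im (partial_deriv i u x))\<^sup>2)" for x
      by (simp add: norm_vec_def L2_set_def sum_nonneg gradient_def cmod_power2)
    then show ?thesis
      using R(2) I(2) by (simp add: gauss_decay_integrable gauss_decay_power2 sum.distrib)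
  qed
  have mom: "(\<integral>x. (norm x)\<^sup>2 * (norm (u x))\<^sup>2 \<partial>lborel)
      = (\<integral>x. (norm x)\<^sup>2 * (Re (u x))\<^sup>2 \<partial>lborel) + (\<integral>x. (norm x)\<^sup>2 * (Im (u x))\<^sup>2 \<partial>lborel)"
  proof -
    have "integrable lborel (\<lambda>x::real^'n. (norm x)\<^sup>2 * (f x)\<^sup>2)" if "gauss_decay f" for f
      by (intro gauss_decay_integrable gauss_decay_poly_mult [OF poly_lt_norm2] gauss_decay_power2 that)
    then show ?thesis using R(1) I(1) by (simp add: cmod_power2 distrib_left)
  qed
  have "(INF w\<in>gauss_polys j. \<integral>x. (norm (u x - w x))\<^sup>2 \<partial>lborel)
      \<le> (\<integral>x. (Re (u x) - V j x * ?g x)\<^sup>2 \<partial>lborel) + (\<integral>x. (Im (u x) - W j x * ?g x)\<^sup>2 \<partial>lborel)"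
    if j: "j < J" for j
  proof -
    let ?w = "\<lambda>x. Complex (V j x * ?g x) (W j x * ?g x)"
    have VW: "poly_lt (Suc j) (V j)" "poly_lt (Suc j) (W j)" using V(1) W(1) j by auto
    have "(INF w\<in>gauss_polys j. \<integral>x. (norm (u x - w x))\<^sup>2 \<partial>lborel) \<le> (\<integral>x. (norm (u x - ?w x))\<^sup>2 \<partial>lborel)"
      using VW b by (intro cINF_lower bdd_belowI2 [of _ 0] poly_lt_imp_gauss_polys) auto
    also have "\<dots> = (\<integral>x. (Re (u x) - V j x * ?g x)\<^sup>2 \<partial>lborel) + (\<integral>x. (Im (u x) - W j x * ?g x)\<^sup>2 \<partial>lborel)"
      using VW b R(1) I(1)
      by (subst integral_cmod_power2) (auto intro!: gauss_decay_diff gauss_decay_poly)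
    finally show ?thesis .
  qed
  then have "(\<Sum>j<J. INF w\<in>gauss_polys j. \<integral>x. (norm (u x - w x))\<^sup>2 \<partial>lborel)
      \<le> (\<Sum>j<J. (\<integral>x. (Re (u x) - V j x * ?g x)\<^sup>2 \<partial>lborel) + (\<integral>x. (Im (u x) - W j x * ?g x)\<^sup>2 \<partial>lborel))"
    by (intro sum_mono) auto
  then have "2 * b * (\<Sum>j<J. INF w\<in>gauss_polys j. \<integral>x. (norm (u x - w x))\<^sup>2 \<partial>lborel)
      \<le> 2 * b * ((\<Sum>j<J. \<integral>x. (Re (u x) - V j x * ?g x)\<^sup>2 \<partial>lborel)
          + (\<Sum>j<J. \<integral>x. (Im (u x) - W j x * ?g x)\<^sup>2 \<partial>lborel))"
    using b by (intro mult_left_mono) (auto simp: sum.distrib)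
  then show "2 * b * (\<Sum>j<J. INF w\<in>gauss_polys j. \<integral>x. (norm (u x - w x))\<^sup>2 \<partial>lborel)
    \<le> (\<integral>x. (norm (gradient u x))\<^sup>2 \<partial>lborel) + b\<^sup>2 * (\<integral>x. (norm x)\<^sup>2 * (norm (u x))\<^sup>2 \<partial>lborel)
      - b * real CARD('n) * (\<integral>x. (norm (u x))\<^sup>2 \<partial>lborel) + \<epsilon>"
    using V(2) W(2) unfolding grad mom integral_cmod_power2 [OF R(1) I(1)]
    by (simp add: algebra_simps)
qed

text \<open>The choice \<open>b = sqrt A / sqrt B\<close> balances the two terms on the right. If
  \<open>A\<close> or \<open>B\<close> is zero, small or large \<open>b\<close> respectively force
  \<open>X \<le> 0\<close>.\<close>

lemma sqrt_mult_sqrt_ge: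
  fixes A B X :: real
  assumes A: "A \<ge> 0" and B: "B \<ge> 0" and le: "\<And>b. b > 0 \<Longrightarrow> b * X \<le> A + b\<^sup>2 * B"
  shows "X \<le> 2 * (sqrt A * sqrt B)"
proof (cases "A > 0 \<and> B > 0")
  case True
  then have b: "sqrt A / sqrt B > 0" by simp
  have "sqrt A / sqrt B * X \<le> A + (sqrt A / sqrt B)\<^sup>2 * B" by (rule le [OF b])
  also have "\<dots> = sqrt A / sqrt B * (2 * (sqrt A * sqrt B))"
    using True by (simp add: power_divide)
  finally show ?thesis using b mult_le_cancel_left_pos by blast
next
  case False
  have "X \<le> 0"
  proof (rule ccontr)
    assume X: "\<not> X \<le> 0"
    show False
    proof (cases "A = 0")
      case True
      \<comment> \<open>For \<open>A = 0\<close> the hypothesis divided by \<open>b\<close> reads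
        \<open>X \<le> b * B\<close>, which this \<open>b\<close> violates.\<close>
      have b: "X / (2 * (B + 1)) > 0" using X B by simp
      have "X / (2 * (B + 1)) * X \<le> X / (2 * (B + 1)) * (X / (2 * (B + 1)) * B)"
        using le [OF b] True by (simp add: power2_eq_square mult.assoc)
      then have "X \<le> X / (2 * (B + 1)) * B" using b mult_le_cancel_left_pos by blast
      moreover have "X / (2 * (B + 1)) * B < X"
      proof -
        have "0 \<le> B * X" using X B by simp
        then have "0 < B * X + X * 2" using X by linarith
        then show ?thesis using B by (simp add: field_simps)
      qed
      ultimately show False by simp
    next
      case A0: False
      then have "B = 0" using False A B by auto
      \<comment> \<open>This \<open>b\<close> turns the hypothesis into
        \<open>A + 1 \<le> A\<close>.\<close>
      then show False using le [of "(A + 1) / X"] X A by (simp add: field_simps)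
    qed
  qed
  then show ?thesis using A B by (simp add: order_trans [of X 0])
qed

theorem corollary1p5:
  fixes u :: "real^'n \<Rightarrow> complex"
  assumes "CARD('n) \<ge> 2"
    and "u \<in> test_functions"
  shows "sqrt (\<integral>x. (norm (gradient u x))\<^sup>2 \<partial>lborel) * sqrt (\<integral>x. (norm x)\<^sup>2 * (norm (u x))\<^sup>2 \<partial>lborel)
           - real CARD('n) / 2 * (\<integral>x. (norm (u x))\<^sup>2 \<partial>lborel)
         \<ge> (INF w\<in>gauss_polys 0. \<integral>x. (norm (u x - w x))\<^sup>2 \<partial>lborel)
           + (INF w\<in>gauss_polys 1. \<integral>x. (norm (u x - w x))\<^sup>2 \<partial>lborel)
           + (INF w\<in>gauss_polys 2. \<integral>x. (norm (u x - w x))\<^sup>2 \<partial>lborel)"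
proof -
  let ?d = "\<lambda>j. INF w\<in>gauss_polys j. \<integral>x. (norm (u x - w x))\<^sup>2 \<partial>lborel"
  let ?A = "\<integral>x. (norm (gradient u x))\<^sup>2 \<partial>lborel"
  let ?B = "\<integral>x. (norm x)\<^sup>2 * (norm (u x))\<^sup>2 \<partial>lborel"
  let ?U = "\<integral>x. (norm (u x))\<^sup>2 \<partial>lborel"
  \<comment> \<open>The infima do not depend on \<open>b\<close>, since \<open>gauss_polys\<close>
    contains all rates; hence \<open>b\<close> can be optimised with them held fixed.\<close>
  have "real CARD('n) * ?U + 2 * (\<Sum>j<3. ?d j) \<le> 2 * (sqrt ?A * sqrt ?B)"
  proof (rule sqrt_mult_sqrt_ge)
    fix b :: real assume "b > 0"
    from deficit_ge [OF assms(2) this, of 3]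
    show "b * (real CARD('n) * ?U + 2 * (\<Sum>j<3. ?d j)) \<le> ?A + b\<^sup>2 * ?B"
      by (simp add: algebra_simps)
  qed simp_all
  moreover have "(\<Sum>j<3. ?d j) = ?d 0 + ?d 1 + ?d 2"
    by (simp add: numeral_3_eq_3 numeral_2_eq_2)
  ultimately show ?thesis by simp
qed

end
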